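(* Let $G$ be a finite group. Then $\mathcal{I}(G)=\zeta(\mathbb{Z}[G])$ if and only if $G$ is abelian.
   Context: For a noetherian integrally closed domain $\mathcal{O}$ with fraction field $F$ and an $\mathcal{O}$-order $\Lambda$ in a finite dimensional separable $F$-algebra $A$, the integrality ring $\mathcal{I}(\Lambda)$ is the $\zeta(\Lambda)$-submodule of $\zeta(A)$ generated by the reduced norms $\mathrm{nr}(H)$ of all matrices $H\in M_n(\Lambda)$, $n\in\mathbb{N}$. $\mathcal{I}(G):=\mathcal{I}(\mathbb{Z}[G])$ (with $A=\mathbb{Q}[G]$); $\zeta(\cdot)$ denotes the centre. *)

theory Defs
  imports "HOL-Algebra.Group" "Jordan_Normal_Form.Determinant" Complex_Main
begin

text \<open>Group ring elements are modelled as complex-valued functions on the carrier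
of G (zero outside the carrier); the coefficient ring is specified by a subset S
of the complex numbers (S = Ints gives Z[G], S = Rats gives Q[G], S = UNIV gives C[G]).\<close>

definition grp_ring :: "('a, 'b) monoid_scheme \<Rightarrow> complex set \<Rightarrow> ('a \<Rightarrow> complex) set" where
  "grp_ring G S = {f. (\<forall>x. x \<notin> carrier G \<longrightarrow> f x = 0) \<and> (\<forall>x \<in> carrier G. f x \<in> S)}"

definition grp_mult :: "('a, 'b) monoid_scheme \<Rightarrow> ('a \<Rightarrow> complex) \<Rightarrow> ('a \<Rightarrow> complex) \<Rightarrow> 'a \<Rightarrow> complex" where
  "grp_mult G f h = (\<lambda>x. if x \<in> carrier G
      then (\<Sum>y\<in>carrier G. f y * h (inv\<^bsub>G\<^esub> y \<otimes>\<^bsub>G\<^esub> x)) else 0)"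

definition grp_centre :: "('a, 'b) monoid_scheme \<Rightarrow> complex set \<Rightarrow> ('a \<Rightarrow> complex) set" where
  "grp_centre G S = {z \<in> grp_ring G S. \<forall>a \<in> grp_ring G S. grp_mult G z a = grp_mult G a z}"

definition is_rep :: "('a, 'b) monoid_scheme \<Rightarrow> nat \<Rightarrow> ('a \<Rightarrow> complex mat) \<Rightarrow> bool" where
  "is_rep G d \<rho> \<longleftrightarrow> (\<forall>g \<in> carrier G. \<rho> g \<in> carrier_mat d d)
     \<and> (\<forall>g \<in> carrier G. \<forall>h \<in> carrier G. \<rho> (g \<otimes>\<^bsub>G\<^esub> h) = \<rho> g * \<rho> h)
     \<and> \<rho> \<one>\<^bsub>G\<^esub> = 1\<^sub>m d"

text \<open>Irreducible: d > 0 and no G-invariant subspace other than 0 and C^d.  Every subspace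
is the image of an idempotent P, and im P is invariant under \<rho> g iff P (\<rho> g) P = (\<rho> g) P.\<close>
definition irr_rep :: "('a, 'b) monoid_scheme \<Rightarrow> nat \<Rightarrow> ('a \<Rightarrow> complex mat) \<Rightarrow> bool" where
  "irr_rep G d \<rho> \<longleftrightarrow> 0 < d \<and> is_rep G d \<rho> \<and>
     \<not> (\<exists>P \<in> carrier_mat d d. P * P = P \<and> P \<noteq> 0\<^sub>m d d \<and> P \<noteq> 1\<^sub>m d
          \<and> (\<forall>g \<in> carrier G. P * \<rho> g * P = \<rho> g * P))"

definition rep_ext :: "('a, 'b) monoid_scheme \<Rightarrow> nat \<Rightarrow> ('a \<Rightarrow> complex mat) \<Rightarrow> ('a \<Rightarrow> complex) \<Rightarrow> complex mat" where
  "rep_ext G d \<rho> f = mat d d (\<lambda>(i, j). \<Sum>g\<in>carrier G. f g * (\<rho> g $$ (i, j)))"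

definition rep_blk :: "('a, 'b) monoid_scheme \<Rightarrow> nat \<Rightarrow> ('a \<Rightarrow> complex mat) \<Rightarrow> nat
      \<Rightarrow> (nat \<Rightarrow> nat \<Rightarrow> 'a \<Rightarrow> complex) \<Rightarrow> complex mat" where
  "rep_blk G d \<rho> n H = mat (n * d) (n * d)
      (\<lambda>(i, j). rep_ext G d \<rho> (H (i div d) (j div d)) $$ (i mod d, j mod d))"

text \<open>Reduced norm of an n x n matrix H over the group ring: the (unique) element z of C[G]
(it lies in the centre of Q[G]) whose image under every irreducible complex representation
\<rho> is the scalar det(\<rho>(H)).  This is the Wedderburn-componentwise description of
nr : M_n(Q[G]) \<rightarrow> centre(Q[G]).\<close>
definition red_norm :: "('a, 'b) monoid_scheme \<Rightarrow> nat \<Rightarrow> (nat \<Rightarrow> nat \<Rightarrow> 'a \<Rightarrow> complex) \<Rightarrow> 'a \<Rightarrow> complex" where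
  "red_norm G n H = (THE z. z \<in> grp_ring G UNIV \<and>
      (\<forall>d \<rho>. irr_rep G d \<rho> \<longrightarrow> rep_ext G d \<rho> z = det (rep_blk G d \<rho> n H) \<cdot>\<^sub>m 1\<^sub>m d))"

definition int_grp_mat :: "('a, 'b) monoid_scheme \<Rightarrow> nat \<Rightarrow> (nat \<Rightarrow> nat \<Rightarrow> 'a \<Rightarrow> complex) \<Rightarrow> bool" where
  "int_grp_mat G n H \<longleftrightarrow> (\<forall>i < n. \<forall>j < n. H i j \<in> grp_ring G \<int>)"

definition integrality_ring :: "('a, 'b) monoid_scheme \<Rightarrow> ('a \<Rightarrow> complex) set" where
  "integrality_ring G = {z. \<exists>(k::nat) c n H.
      (\<forall>i < k. c i \<in> grp_centre G \<int> \<and> 0 < n i \<and> int_grp_mat G (n i) (H i))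
      \<and> z = (\<lambda>x. \<Sum>i<k. grp_mult G (c i) (red_norm G (n i) (H i)) x)}"

end

theory Submission
  imports Defs "Jordan_Normal_Form.Spectral_Radius" "HOL-Algebra.Generated_Groups"
begin

text \<open>If \<open>G\<close> is abelian, all irreducible representations are one-dimensional and the reduced norm is the
determinant over the commutative ring \<open>\<int>[G]\<close>.

Conversely, suppose that \<open>nr h\<close> is integral and central for all \<open>h \<in> \<int>[G]\<close>. For a subgroup \<open>C\<close> whose normal
closure \<open>N\<close> has abelian quotient, the sum of the elements of \<open>C\<close> is singular in every irreducible
representation that is not trivial on \<open>N\<close>, hence its reduced norm is \<open>|C| / |N|\<close> times the sum of
the elements of \<open>N\<close>; integrality forces \<open>C = N\<close>. If \<open>G\<close> is not abelian, let \<open>K\<close> be maximal among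
the normal subgroups with nonabelian quotient. By the above every subgroup containing \<open>K\<close> is normal, so \<open>G\<close>
acts on each cyclic subgroup of \<open>G/K\<close> through an abelian group, and commutators are central modulo
\<open>K\<close>. Choose \<open>x\<close> and \<open>y\<close> not commuting modulo \<open>K\<close>, and let \<open>M\<close> be generated by \<open>K\<close> and their
commutator. Then \<open>G/M\<close> is abelian, so the coefficients of \<open>z = nr x\<close> on \<open>xM\<close> add up to \<open>1\<close>; but the
conjugates of \<open>x\<close> fill \<open>xM/K\<close>, so the sum of \<open>z\<close> over each coset of \<open>K\<close> in \<open>xM\<close> is the same integer, and
\<open>[M : K]\<close> divides \<open>1\<close>, a contradiction.

The reduced norm \<open>nr x\<close> is obtained without character theory: decompose the regular representation into
irreducible ones, let an operator \<open>T\<close> act on each summand by the scalar that is wanted there, and apply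
\<open>T\<close> to the identity.\<close>

section \<open>Rank factorisation of complex matrices\<close>

lemma mat_mult_assoc [simp]:
  "dim_col A = dim_row B \<Longrightarrow> dim_col B = dim_row C \<Longrightarrow> A * B * C = A * (B * C :: 'a :: semiring_0 mat)"
  by (rule assoc_mult_mat[of A "dim_row A" "dim_col A" B "dim_col B" C "dim_col C"]) auto

text \<open>Since \<open>v $ k\<close> is nonzero, the relation \<open>N *\<^sub>v v = 0\<close>
  expresses column \<open>k\<close> of \<open>N\<close> through the other columns, so
  \<open>N\<close> factors through one dimension less.\<close>

lemma singular_mat_factor:
  fixes N :: "complex mat"
  assumes N: "N \<in> carrier_mat m r" and v: "v \<in> carrier_vec r" "v \<noteq> 0\<^sub>v r" "N *\<^sub>v v = 0\<^sub>v m"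
  shows "0 < r \<and> (\<exists>U \<in> carrier_mat m (r - 1). \<exists>W \<in> carrier_mat (r - 1) r. N = U * W)"
proof -
  obtain k where k: "k < r" "v $ k \<noteq> 0"
    using v by (metis carrier_vecD eq_vecI index_zero_vec(1) index_zero_vec(2))
  \<comment> \<open>\<open>ins\<close> enumerates the indices below \<open>r\<close> other than
    \<open>k\<close>. \<open>U\<close> is \<open>N\<close> without column \<open>k\<close>;
    \<open>W\<close> copies the remaining columns and rebuilds column \<open>k\<close> with
    coefficients \<open>- v $ t / v $ k\<close>.\<close>
  define ins where "ins j = (if j < k then j else Suc j)" for j
  have bij: "bij_betw ins {..<r - 1} ({..<r} - {k})"
  proof (rule bij_betw_byWitness[where f' = "\<lambda>j. if j < k then j else j - 1"])
  qed (use k in \<open>auto simp: ins_def\<close>)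
  define U where "U = mat m (r - 1) (\<lambda>(i, j). N $$ (i, ins j))"
  define W where "W = mat (r - 1) r (\<lambda>(j, l). (if ins j = l then 1 else 0)
     - (if l = k then v $ ins j / v $ k else 0))"
  have "U * W = N"
  proof (rule eq_matI)
    fix i l assume "i < dim_row N" "l < dim_col N"
    then have i: "i < m" and l: "l < r" using N by auto
    have "(U * W) $$ (i, l) = (\<Sum>j<r - 1. N $$ (i, ins j) * ((if ins j = l then 1 else 0)
     - (if l = k then v $ ins j / v $ k else 0)))"
      using i l by (simp add: U_def W_def scalar_prod_def atLeast0LessThan)
    also have "\<dots> = (\<Sum>t\<in>{..<r} - {k}. N $$ (i, t) * ((if t = l then 1 else 0)
     - (if l = k then v $ t / v $ k else 0)))"
      by (rule sum.reindex_bij_betw[OF bij])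
    also have "\<dots> = N $$ (i, l)"
    proof (cases "l = k")
      case False
      then show ?thesis using l by (simp add: if_distrib[of "\<lambda>x. _ * x"] cong: if_cong)
    next
      case True
      have "(\<Sum>t<r. N $$ (i, t) * v $ t) = (N *\<^sub>v v) $ i"
        using i N v(1) by (simp add: scalar_prod_def atLeast0LessThan)
      also have "\<dots> = 0" using v(3) i by simp
      finally have "(\<Sum>t\<in>{..<r} - {k}. N $$ (i, t) * v $ t) = - (N $$ (i, k) * v $ k)"
        using k by (simp add: sum.remove[of _ k] add_eq_0_iff)
      moreover have "(\<Sum>t\<in>{..<r} - {k}. N $$ (i, t) * ((if t = l then 1 else 0)
          - (if l = k then v $ t / v $ k else 0)))
        = (\<Sum>t\<in>{..<r} - {k}. - ((N $$ (i, t) * v $ t) / v $ k))"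
        using True by (intro sum.cong) auto
      ultimately show ?thesis
        using True k by (simp add: sum_negf flip: sum_divide_distrib)
    qed
    finally show "(U * W) $$ (i, l) = N $$ (i, l)" .
  qed (use N in \<open>auto simp: U_def W_def\<close>)
  moreover have "U \<in> carrier_mat m (r - 1)" "W \<in> carrier_mat (r - 1) r"
    by (auto simp: U_def W_def)
  ultimately show ?thesis using k by auto
qed

lemma obtain_mat_inverse:
  fixes A :: "complex mat"
  assumes A: "A \<in> carrier_mat n n" and "det A \<noteq> 0"
  obtains B where "B \<in> carrier_mat n n" "B * A = 1\<^sub>m n" "A * B = 1\<^sub>m n"
  using det_non_zero_imp_unit[OF assms, unfolded Units_def, of "()"]
  by (auto simp: ring_mat_def)

text \<open>With \<open>H\<close> the conjugate transpose of \<open>A\<close>, the Gram matrix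
  \<open>H * A\<close> is invertible, because \<open>H * A\<close> killing \<open>v\<close> makes
  the squared norm of \<open>A *\<^sub>v v\<close> vanish. The left inverse is the inverse of
  \<open>H * A\<close> times \<open>H\<close>.\<close>

lemma injective_mat_left_inverse:
  fixes A :: "complex mat"
  assumes A: "A \<in> carrier_mat m r"
    and inj: "\<And>v. v \<in> carrier_vec r \<Longrightarrow> A *\<^sub>v v = 0\<^sub>v m \<Longrightarrow> v = 0\<^sub>v r"
  shows "\<exists>L \<in> carrier_mat r m. L * A = 1\<^sub>m r"
proof -
  define H where "H = transpose_mat (map_mat cnj A)"
  have H: "H \<in> carrier_mat r m" using A by (auto simp: H_def)
  have HA: "H * A \<in> carrier_mat r r" using A H by auto
  have "det (H * A) \<noteq> 0"
  proof
    assume "det (H * A) = 0"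
    then obtain v where v: "v \<in> carrier_vec r" "v \<noteq> 0\<^sub>v r" "(H * A) *\<^sub>v v = 0\<^sub>v r"
      using det_0_iff_vec_prod_zero[OF HA] by auto
    define w where "w = A *\<^sub>v v"
    have w: "w \<in> carrier_vec m" using A v by (auto simp: w_def)
    have Hw: "H *\<^sub>v w = 0\<^sub>v r" using v H A by (simp add: w_def)
    \<comment> \<open>The squared norm of \<open>w\<close> is the Hermitian pairing of
      \<open>H *\<^sub>v w\<close> with \<open>v\<close>, hence zero.\<close>
    have "(\<Sum>i<m. w $ i * cnj (w $ i)) = (\<Sum>i<m. \<Sum>j<r. w $ i * (cnj (A $$ (i, j)) * cnj (v $ j)))"
      using A v by (intro sum.cong)
        (auto simp: w_def scalar_prod_def atLeast0LessThan sum_distrib_left)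
    also have "\<dots> = (\<Sum>j<r. \<Sum>i<m. w $ i * (cnj (A $$ (i, j)) * cnj (v $ j)))"
      by (rule sum.swap)
    also have "\<dots> = (\<Sum>j<r. cnj (v $ j) * (H *\<^sub>v w) $ j)"
      using A w by (intro sum.cong)
        (auto simp: H_def scalar_prod_def atLeast0LessThan sum_distrib_left intro!: sum.cong)
    also have "\<dots> = 0" by (simp add: Hw)
    finally have "(\<Sum>i<m. complex_of_real ((cmod (w $ i))\<^sup>2)) = 0"
      by (simp only: complex_norm_square)
    then have "(\<Sum>i<m. (cmod (w $ i))\<^sup>2) = 0"
      by (metis of_real_sum of_real_eq_0_iff)
    then have "\<forall>i<m. w $ i = 0" by (subst (asm) sum_nonneg_eq_0_iff) auto
    then have "w = 0\<^sub>v m" using w by (intro eq_vecI) auto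
    then show False using inj v by (auto simp: w_def)
  qed
  then obtain B where B: "B \<in> carrier_mat r r" "B * (H * A) = 1\<^sub>m r"
    using obtain_mat_inverse[OF HA] by metis
  have "(B * H) * A = 1\<^sub>m r" using B H A by simp
  then show ?thesis using B H by (intro bexI[of _ "B * H"]) auto
qed

text \<open>Take \<open>r\<close> minimal: a nonzero kernel vector of \<open>A\<close> or of the transpose of \<open>B\<close> would give a
factorisation through dimension \<open>r - 1\<close>.\<close>
lemma rank_factorization:
  fixes C :: "complex mat"
  assumes C: "C \<in> carrier_mat m n"
  obtains r A B L R where "r \<le> n" "A \<in> carrier_mat m r" "B \<in> carrier_mat r n" "C = A * B"
    "L \<in> carrier_mat r m" "L * A = 1\<^sub>m r" "R \<in> carrier_mat n r" "B * R = 1\<^sub>m r"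
proof -
  define fac where "fac r \<longleftrightarrow> (\<exists>A \<in> carrier_mat m r. \<exists>B \<in> carrier_mat r n. C = A * B)" for r
  have "fac n" unfolding fac_def by (rule bexI[OF _ C], rule bexI[of _ "1\<^sub>m n"]) (use C in auto)
  define r where "r = (LEAST r. fac r)"
  have "fac r" unfolding r_def using \<open>fac n\<close> by (rule LeastI)
  have "r \<le> n" unfolding r_def using \<open>fac n\<close> by (rule Least_le)
  have least: "\<not> fac s" if "s < r" for s using that not_less_Least unfolding r_def by blast
  obtain A B where AB: "A \<in> carrier_mat m r" "B \<in> carrier_mat r n" "C = A * B"
    using \<open>fac r\<close> unfolding fac_def by blast
  have "\<exists>L \<in> carrier_mat r m. L * A = 1\<^sub>m r"
  proof (rule injective_mat_left_inverse[OF AB(1)], rule ccontr)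
    fix v assume v: "v \<in> carrier_vec r" "A *\<^sub>v v = 0\<^sub>v m" "v \<noteq> 0\<^sub>v r"
    obtain U W where UW: "U \<in> carrier_mat m (r - 1)" "W \<in> carrier_mat (r - 1) r" "A = U * W" "0 < r"
      using singular_mat_factor[OF AB(1) v(1,3,2)] by blast
    have "C = U * (W * B)" using UW AB by simp
    then have "fac (r - 1)" unfolding fac_def using UW(1) mult_carrier_mat[OF UW(2) AB(2)] by blast
    then show False using least UW by simp
  qed
  moreover have "\<exists>L \<in> carrier_mat r n. L * transpose_mat B = 1\<^sub>m r"
  proof (rule injective_mat_left_inverse, use AB in simp, rule ccontr)
    fix v assume v: "v \<in> carrier_vec r" "transpose_mat B *\<^sub>v v = 0\<^sub>v n" "v \<noteq> 0\<^sub>v r"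
    obtain U W where UW: "U \<in> carrier_mat n (r - 1)" "W \<in> carrier_mat (r - 1) r"
        "transpose_mat B = U * W" "0 < r"
      using singular_mat_factor[OF _ v(1,3,2)] AB by auto
    have "B = transpose_mat (U * W)" using UW(3) by (metis Matrix.transpose_transpose)
    also have "\<dots> = transpose_mat W * transpose_mat U" by (rule transpose_mult[OF UW(1,2)])
    finally have "C = (A * transpose_mat W) * transpose_mat U" using UW AB by simp
    moreover have "A * transpose_mat W \<in> carrier_mat m (r - 1)" "transpose_mat U \<in> carrier_mat (r - 1) n"
      using UW AB by auto
    ultimately have "fac (r - 1)" unfolding fac_def by blast
    then show False using least UW by simp
  qed
  then obtain L where L: "L \<in> carrier_mat r n" "L * transpose_mat B = 1\<^sub>m r" by blast
  have "B * transpose_mat L = transpose_mat (L * transpose_mat B)"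
    using L AB by (subst transpose_mult[of _ r n _ r]) auto
  then have "B * transpose_mat L = 1\<^sub>m r" using L by simp
  moreover have "transpose_mat L \<in> carrier_mat n r" using L by simp
  ultimately show thesis using that AB \<open>r \<le> n\<close> by blast
qed

text \<open>The product \<open>R * L\<close> of the one-sided inverses of the rank factors works.
  Such an \<open>X\<close> turns image and kernel of \<open>C\<close> into the idempotents
  \<open>C * X\<close> and \<open>1 - X * C\<close>, the form in which \<open>irr_rep\<close> speaks
  of subspaces.\<close>

lemma mat_von_Neumann_regular:
  fixes C :: "complex mat"
  assumes C: "C \<in> carrier_mat m n"
  obtains X where "X \<in> carrier_mat n m" "C * X * C = C"
proof -
  obtain r A B L R where f: "A \<in> carrier_mat m r" "B \<in> carrier_mat r n" "C = A * B"
    "L \<in> carrier_mat r m" "L * A = 1\<^sub>m r" "R \<in> carrier_mat n r" "B * R = 1\<^sub>m r"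
    using rank_factorization[OF C] by metis
  have "C * (R * L) * C = A * ((B * R) * (L * A) * B)" using f(1,2,4,6) by (simp add: f(3))
  also have "\<dots> = C" unfolding f(5,7) using f(1-3) by simp
  finally show thesis using that[of "R * L"] f by auto
qed

text \<open>Both products have the same trace, which is \<open>m\<close> for one and
  \<open>n\<close> for the other, and the complex numbers have characteristic zero.\<close>

lemma mutually_inverse_mats_same_dim:
  fixes C :: "complex mat"
  assumes C: "C \<in> carrier_mat m n" and X: "X \<in> carrier_mat n m"
    and CX: "C * X = 1\<^sub>m m" and XC: "X * C = 1\<^sub>m n"
  shows "m = n"
proof -
  have "(\<Sum>i<m. (C * X) $$ (i, i)) = (\<Sum>i<m. \<Sum>j<n. C $$ (i, j) * X $$ (j, i))"
    using C X by (intro sum.cong) (auto simp: scalar_prod_def atLeast0LessThan)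
  also have "\<dots> = (\<Sum>j<n. \<Sum>i<m. C $$ (i, j) * X $$ (j, i))" by (rule sum.swap)
  also have "\<dots> = (\<Sum>j<n. (X * C) $$ (j, j))"
    using C X by (intro sum.cong) (auto simp: scalar_prod_def atLeast0LessThan mult.commute)
  finally have "(of_nat m :: complex) = of_nat n" by (simp add: CX XC)
  then show ?thesis by simp
qed

section \<open>Sums of families of matrices\<close>

text \<open>The dimensions are explicit, so the empty sum is the zero matrix of that size.\<close>

definition sum_mat :: "nat \<Rightarrow> nat \<Rightarrow> ('a \<Rightarrow> complex mat) \<Rightarrow> 'a set \<Rightarrow> complex mat" where
  "sum_mat m n F S = mat m n (\<lambda>ij. \<Sum>s\<in>S. F s $$ ij)"

lemma sum_mat_carrier [simp]: "sum_mat m n F S \<in> carrier_mat m n"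
  and dim_sum_mat [simp]: "dim_row (sum_mat m n F S) = m" "dim_col (sum_mat m n F S) = n"
  by (simp_all add: sum_mat_def)

lemma sum_mat_cong:
  "S = T \<Longrightarrow> (\<And>s. s \<in> T \<Longrightarrow> F s = H s) \<Longrightarrow> sum_mat m n F S = sum_mat m n H T"
  by (simp add: sum_mat_def)

lemma sum_mat_reindex:
  "bij_betw p S T \<Longrightarrow> sum_mat m n (\<lambda>s. F (p s)) S = sum_mat m n F T"
  unfolding sum_mat_def
  by (intro cong_mat refl sum.reindex_bij_betw[where g = "\<lambda>s. F s $$ _"])

lemma mult_sum_mat:
  assumes "X \<in> carrier_mat k m" "\<And>s. s \<in> S \<Longrightarrow> F s \<in> carrier_mat m n"
  shows "X * sum_mat m n F S = sum_mat k n (\<lambda>s. X * F s) S"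
proof (rule eq_matI)
  fix i j assume "i < dim_row (sum_mat k n (\<lambda>s. X * F s) S)" "j < dim_col (sum_mat k n (\<lambda>s. X * F s) S)"
  then have ij: "i < k" "j < n" by auto
  have "(X * sum_mat m n F S) $$ (i, j) = (\<Sum>l<m. \<Sum>s\<in>S. X $$ (i, l) * F s $$ (l, j))"
    using assms ij by (simp add: sum_mat_def scalar_prod_def atLeast0LessThan sum_distrib_left)
  also have "\<dots> = (\<Sum>s\<in>S. \<Sum>l<m. X $$ (i, l) * F s $$ (l, j))" by (rule sum.swap)
  also have "\<dots> = (\<Sum>s\<in>S. (X * F s) $$ (i, j))"
    by (rule sum.cong[OF refl], frule assms(2))
      (use assms(1) ij in \<open>simp add: scalar_prod_def atLeast0LessThan\<close>)
  finally show "(X * sum_mat m n F S) $$ (i, j) = sum_mat k n (\<lambda>s. X * F s) S $$ (i, j)"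
    using ij by (simp add: sum_mat_def)
qed (use assms in auto)

lemma sum_mat_mult:
  assumes "X \<in> carrier_mat n k" "\<And>s. s \<in> S \<Longrightarrow> F s \<in> carrier_mat m n"
  shows "sum_mat m n F S * X = sum_mat m k (\<lambda>s. F s * X) S"
proof (rule eq_matI)
  fix i j assume "i < dim_row (sum_mat m k (\<lambda>s. F s * X) S)" "j < dim_col (sum_mat m k (\<lambda>s. F s * X) S)"
  then have ij: "i < m" "j < k" by auto
  have "(sum_mat m n F S * X) $$ (i, j) = (\<Sum>l<n. \<Sum>s\<in>S. F s $$ (i, l) * X $$ (l, j))"
    using assms ij by (simp add: sum_mat_def scalar_prod_def atLeast0LessThan sum_distrib_right)
  also have "\<dots> = (\<Sum>s\<in>S. \<Sum>l<n. F s $$ (i, l) * X $$ (l, j))" by (rule sum.swap)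
  also have "\<dots> = (\<Sum>s\<in>S. (F s * X) $$ (i, j))"
    by (rule sum.cong[OF refl], frule assms(2))
      (use assms(1) ij in \<open>simp add: scalar_prod_def atLeast0LessThan\<close>)
  finally show "(sum_mat m n F S * X) $$ (i, j) = sum_mat m k (\<lambda>s. F s * X) S $$ (i, j)"
    using ij by (simp add: sum_mat_def)
qed (use assms in auto)

lemma sum_mat_const:
  "M \<in> carrier_mat m n \<Longrightarrow> sum_mat m n (\<lambda>s. M) S = of_nat (card S) \<cdot>\<^sub>m M"
  by (rule eq_matI) (auto simp: sum_mat_def)

section \<open>Intertwiners and complete reducibility\<close>

definition intertwiner ::
  "('a, 'b) monoid_scheme \<Rightarrow> nat \<Rightarrow> ('a \<Rightarrow> complex mat) \<Rightarrow> nat \<Rightarrow> ('a \<Rightarrow> complex mat) \<Rightarrow> complex mat \<Rightarrow> bool"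
  where "intertwiner G d \<rho> e \<sigma> C \<longleftrightarrow>
    C \<in> carrier_mat e d \<and> (\<forall>g \<in> carrier G. C * \<rho> g = \<sigma> g * C)"

lemma intertwinerD:
  assumes "intertwiner G d \<rho> e \<sigma> C"
  shows "C \<in> carrier_mat e d" "g \<in> carrier G \<Longrightarrow> C * \<rho> g = \<sigma> g * C"
  using assms by (auto simp: intertwiner_def)

lemma intertwiner_comp:
  assumes "intertwiner G d \<rho> e \<sigma> C" "intertwiner G e \<sigma> f \<tau> D"
    "is_rep G d \<rho>" "is_rep G e \<sigma>" "is_rep G f \<tau>"
  shows "intertwiner G d \<rho> f \<tau> (D * C)"
  unfolding intertwiner_def
proof safe
  show "D * C \<in> carrier_mat f d" using assms intertwinerD(1) by (metis mult_carrier_mat)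
  fix g assume g: "g \<in> carrier G"
  have c: "C \<in> carrier_mat e d" "D \<in> carrier_mat f e" "\<rho> g \<in> carrier_mat d d"
    "\<sigma> g \<in> carrier_mat e e" "\<tau> g \<in> carrier_mat f f"
    using assms g by (auto simp: intertwiner_def is_rep_def)
  have "D * C * \<rho> g = D * (C * \<rho> g)" using c by simp
  also have "\<dots> = D * \<sigma> g * C" using c intertwinerD(2)[OF assms(1) g] by simp
  also have "\<dots> = \<tau> g * (D * C)" using c intertwinerD(2)[OF assms(2) g] by simp
  finally show "D * C * \<rho> g = \<tau> g * (D * C)" .
qed

lemma irr_repD:
  assumes "irr_rep G d \<rho>"
  shows "0 < d" "is_rep G d \<rho>"
    "P \<in> carrier_mat d d \<Longrightarrow> P * P = P \<Longrightarrow> (\<And>g. g \<in> carrier G \<Longrightarrow> P * \<rho> g * P = \<rho> g * P)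
      \<Longrightarrow> P = 0\<^sub>m d d \<or> P = 1\<^sub>m d"
  using assms by (auto simp: irr_rep_def)

text \<open>Image and kernel of \<open>C\<close> are invariant. They are represented by the
  idempotents \<open>C * X\<close> and \<open>1 - X * C\<close> of a generalised inverse
  \<open>X\<close>; irreducibility makes the first the identity and the second zero.\<close>

lemma Schur_lemma:
  assumes \<rho>: "irr_rep G d \<rho>" and \<sigma>: "irr_rep G e \<sigma>"
    and C: "intertwiner G d \<rho> e \<sigma> C" and nz: "C \<noteq> 0\<^sub>m e d"
  shows "e = d" and "det C \<noteq> 0"
proof -
  have cC: "C \<in> carrier_mat e d" by (rule intertwinerD(1)[OF C])
  obtain X where X: "X \<in> carrier_mat d e" "C * X * C = C"
    using mat_von_Neumann_regular[OF cC] by blast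
  have \<rho>c: "\<rho> g \<in> carrier_mat d d" and \<sigma>c: "\<sigma> g \<in> carrier_mat e e" if "g \<in> carrier G" for g
    using irr_repD(2)[OF \<rho>] irr_repD(2)[OF \<sigma>] that by (auto simp: is_rep_def)
  \<comment> \<open>\<open>C * X\<close> projects onto the image of \<open>C\<close>, which is
    invariant under \<sigma>; it is not zero because \<open>C * X * C = C\<close> is not.\<close>
  have CX: "C * X = 1\<^sub>m e"
  proof -
    have "C * X * (C * X) = (C * X * C) * X" using cC X(1) by simp
    then have "C * X * (C * X) = C * X" by (simp only: X(2))
    moreover have "C * X * \<sigma> g * (C * X) = \<sigma> g * (C * X)" if g: "g \<in> carrier G" for g
    proof -
      have "C * X * \<sigma> g * (C * X) = C * X * ((\<sigma> g * C) * X)" using cC X(1) \<sigma>c[OF g] by simp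
      also have "\<dots> = (C * X * C) * (\<rho> g * X)"
        unfolding intertwinerD(2)[OF C g, symmetric] using cC X(1) \<rho>c[OF g] by simp
      also have "\<dots> = (C * \<rho> g) * X" unfolding X(2) using cC X(1) \<rho>c[OF g] by simp
      also have "\<dots> = \<sigma> g * (C * X)"
        unfolding intertwinerD(2)[OF C g] using cC X(1) \<sigma>c[OF g] by simp
      finally show ?thesis .
    qed
    ultimately have "C * X = 0\<^sub>m e e \<or> C * X = 1\<^sub>m e"
      using irr_repD(3)[OF \<sigma>, of "C * X"] cC X(1) by auto
    then show ?thesis using X(2) nz cC by auto
  qed
  have XC: "X * C = 1\<^sub>m d"
  proof -
    \<comment> \<open>\<open>R\<close> projects onto the kernel of \<open>C\<close>.\<close>
    define R where "R = 1\<^sub>m d - X * C"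
    have cXC: "X * C \<in> carrier_mat d d" using cC X(1) by simp
    have R: "R \<in> carrier_mat d d" unfolding R_def by (rule minus_carrier_mat[OF cXC])
    have CR: "C * R = 0\<^sub>m e d"
    proof -
      have "C * R = C * 1\<^sub>m d - C * (X * C)"
        unfolding R_def by (rule mult_minus_distrib_mat[OF cC _ cXC]) simp
      also have "C * (X * C) = C * X * C" using X(1) cC by simp
      also have "\<dots> = C" by (rule X(2))
      finally show ?thesis using cC by simp
    qed
    \<comment> \<open>\<open>R\<close> fixes whatever \<open>C\<close> kills. With the identity for
      \<open>\<rho>'\<close> this is idempotence, with \<open>\<rho> g\<close> it is invariance of
      the kernel.\<close>
    have key: "R * (\<rho>' * R) = \<rho>' * R" if "\<rho>' \<in> carrier_mat d d" "C * (\<rho>' * R) = 0\<^sub>m e d" for \<rho>'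
    proof -
      have "R * (\<rho>' * R) = 1\<^sub>m d * (\<rho>' * R) - X * C * (\<rho>' * R)"
        unfolding R_def by (rule minus_mult_distrib_mat[OF _ cXC]) (use that R in \<open>auto simp: R_def\<close>)
      also have "X * C * (\<rho>' * R) = 0\<^sub>m d d" using that(1) X(1) cC R by (simp add: that(2))
      also have "1\<^sub>m d * (\<rho>' * R) - 0\<^sub>m d d = \<rho>' * R" using that(1) R by (intro eq_matI) auto
      finally show ?thesis .
    qed
    have "R * R = R" using key[of "1\<^sub>m d"] R CR by simp
    moreover have "R * \<rho> g * R = \<rho> g * R" if g: "g \<in> carrier G" for g
    proof -
      have "C * (\<rho> g * R) = (C * \<rho> g) * R" using cC R \<rho>c[OF g] by simp
      also have "\<dots> = \<sigma> g * (C * R)"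
        unfolding intertwinerD(2)[OF C g] using cC R \<sigma>c[OF g] by simp
      also have "\<dots> = 0\<^sub>m e d" using \<sigma>c[OF g] by (simp add: CR)
      finally show ?thesis using key[OF \<rho>c[OF g]] R \<rho>c[OF g] by simp
    qed
    ultimately have "R = 0\<^sub>m d d \<or> R = 1\<^sub>m d" by (rule irr_repD(3)[OF \<rho> R])
    moreover have "R \<noteq> 1\<^sub>m d" using CR cC nz by auto
    ultimately have "R = 0\<^sub>m d d" by simp
    have "X * C + R = 1\<^sub>m d" unfolding R_def using cC X(1) by (intro eq_matI) auto
    then show ?thesis using \<open>R = 0\<^sub>m d d\<close> cXC by simp
  qed
  show "e = d" by (rule mutually_inverse_mats_same_dim[OF cC X(1) CX XC])
  then have "det C * det X = 1" using det_mult[of C d X] cC X(1) CX by simp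
  then show "det C \<noteq> 0" by auto
qed

locale finite_group = group G for G (structure) +
  assumes finite_carrier: "finite (carrier G)"
begin

lemma bij_left_mult: "h \<in> carrier G \<Longrightarrow> bij_betw (\<lambda>g. h \<otimes> g) (carrier G) (carrier G)"
  by (rule bij_betw_byWitness[where f' = "\<lambda>g. inv h \<otimes> g"]) (auto simp flip: m_assoc)

lemma rep_carrier: "is_rep G d \<rho> \<Longrightarrow> g \<in> carrier G \<Longrightarrow> \<rho> g \<in> carrier_mat d d"
  and rep_mult: "is_rep G d \<rho> \<Longrightarrow> g \<in> carrier G \<Longrightarrow> h \<in> carrier G \<Longrightarrow> \<rho> (g \<otimes> h) = \<rho> g * \<rho> h"
  and rep_one: "is_rep G d \<rho> \<Longrightarrow> \<rho> \<one> = 1\<^sub>m d"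
  by (auto simp: is_rep_def)

lemma rep_inv:
  assumes "is_rep G d \<rho>" "g \<in> carrier G"
  shows "\<rho> g * \<rho> (inv g) = 1\<^sub>m d" "\<rho> (inv g) * \<rho> g = 1\<^sub>m d"
  using rep_mult[OF assms(1), of g "inv g"] rep_mult[OF assms(1), of "inv g" g] rep_one[OF assms(1)] assms
  by auto

section \<open>Maschke's theorem\<close>

text \<open>The image of \<open>Q\<close> is a subrepresentation. In a rank factorisation
  \<open>Q = A * B\<close>, the factor \<open>A\<close> is its inclusion, \<open>B\<close> the
  projection onto it, and \<open>B * \<rho> g * A\<close> the action in the new coordinates.\<close>

lemma commuting_idempotent_split:
  assumes rep: "is_rep G d \<rho>" and Q: "Q \<in> carrier_mat d d" "Q * Q = Q" "Q \<noteq> 1\<^sub>m d"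
    and comm: "\<And>g. g \<in> carrier G \<Longrightarrow> Q * \<rho> g = \<rho> g * Q"
  obtains r \<sigma> A B where "r < d" "is_rep G r \<sigma>" "intertwiner G r \<sigma> d \<rho> A"
    "intertwiner G d \<rho> r \<sigma> B" "A * B = Q"
proof -
  obtain r A B L R where f: "r \<le> d" "A \<in> carrier_mat d r" "B \<in> carrier_mat r d" "Q = A * B"
    "L \<in> carrier_mat r d" "L * A = 1\<^sub>m r" "R \<in> carrier_mat d r" "B * R = 1\<^sub>m r"
    using rank_factorization[OF Q(1)] by metis
  \<comment> \<open>Cancelling \<open>A\<close> by \<open>L\<close> and \<open>B\<close> by
    \<open>R\<close> in \<open>Q * Q = Q\<close> leaves \<open>B * A = 1\<close>.\<close>
  have "L * (Q * Q) * R = (L * A) * (B * A) * (B * R)"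
    unfolding f(4) using f(2,3,5,7) by simp
  also have "\<dots> = B * A" unfolding f(6,8) using f(2,3) by simp
  finally have "B * A = L * Q * R" by (simp only: Q(2))
  also have "\<dots> = (L * A) * (B * R)" unfolding f(4) using f(2,3,5,7) by simp
  also have "\<dots> = 1\<^sub>m r" unfolding f(6,8) by simp
  finally have BA: "B * A = 1\<^sub>m r" .
  \<comment> \<open>For \<open>r = d\<close> the factors would be square and mutually inverse, so
    \<open>Q\<close> would be the identity.\<close>
  have "r \<noteq> d"
  proof
    assume "r = d"
    then have "A * B = 1\<^sub>m d" using mat_mult_left_right_inverse[of B d A] f BA by simp
    then show False using f Q by simp
  qed
  define \<sigma> where "\<sigma> g = B * \<rho> g * A" for g
  have A\<sigma>: "A * \<sigma> g = \<rho> g * A" if g: "g \<in> carrier G" for g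
  proof -
    note c = rep_carrier[OF rep g]
    have "A * \<sigma> g = (A * B) * \<rho> g * A" using f(2,3) c by (simp add: \<sigma>_def)
    also have "\<dots> = \<rho> g * (A * B) * A" using comm[OF g] by (simp only: f(4))
    also have "\<dots> = \<rho> g * A * (B * A)" using f(2,3) c by simp
    also have "\<dots> = \<rho> g * A" unfolding BA using f(2,3) c by simp
    finally show ?thesis .
  qed
  have B\<sigma>: "B * \<rho> g = \<sigma> g * B" if g: "g \<in> carrier G" for g
  proof -
    note c = rep_carrier[OF rep g]
    have "\<sigma> g * B = B * (\<rho> g * (A * B))" using f(2,3) c by (simp add: \<sigma>_def)
    also have "\<dots> = B * (A * B * \<rho> g)" using comm[OF g] by (simp only: f(4))
    also have "\<dots> = (B * A) * B * \<rho> g" using f(2,3) c by simp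
    also have "\<dots> = B * \<rho> g" unfolding BA using f(2,3) c by simp
    finally show ?thesis by simp
  qed
  have "is_rep G r \<sigma>" unfolding is_rep_def
  proof (intro conjI ballI)
    show "\<sigma> g \<in> carrier_mat r r" if g: "g \<in> carrier G" for g
      using f rep_carrier[OF rep g] by (auto simp: \<sigma>_def intro!: mult_carrier_mat[of _ r d])
    show "\<sigma> \<one> = 1\<^sub>m r" using f(2,3) rep by (simp add: \<sigma>_def rep_one BA)
    fix g h assume g: "g \<in> carrier G" and h: "h \<in> carrier G"
    note c = rep_carrier[OF rep g] rep_carrier[OF rep h]
    have "\<sigma> (g \<otimes> h) = B * \<rho> g * (\<rho> h * A)" using f(2,3) c by (simp add: \<sigma>_def rep_mult[OF rep g h])
    also have "\<dots> = B * \<rho> g * (A * \<sigma> h)" by (simp only: A\<sigma>[OF h])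
    also have "\<dots> = \<sigma> g * \<sigma> h" using f(2,3) c by (simp add: \<sigma>_def)
    finally show "\<sigma> (g \<otimes> h) = \<sigma> g * \<sigma> h" .
  qed
  moreover have "intertwiner G r \<sigma> d \<rho> A" "intertwiner G d \<rho> r \<sigma> B"
    using f A\<sigma> B\<sigma> by (auto simp: intertwiner_def)
  moreover have "r < d" using \<open>r \<noteq> d\<close> f by simp
  ultimately show thesis using that f(4) by blast
qed

text \<open>\<open>Q\<close> is the average of the conjugates of \<open>P\<close>. It has the same
  image as \<open>P\<close>, but its kernel is invariant as well.\<close>

lemma Maschke_idempotent:
  assumes rep: "is_rep G d \<rho>" and P: "P \<in> carrier_mat d d" "P \<noteq> 0\<^sub>m d d" "P \<noteq> 1\<^sub>m d" "P * P = P"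
    and inv: "\<And>g. g \<in> carrier G \<Longrightarrow> P * \<rho> g * P = \<rho> g * P"
  obtains Q where "Q \<in> carrier_mat d d" "Q * Q = Q" "Q \<noteq> 0\<^sub>m d d" "Q \<noteq> 1\<^sub>m d"
    "\<And>g. g \<in> carrier G \<Longrightarrow> Q * \<rho> g = \<rho> g * Q"
proof -
  define F where "F g = \<rho> g * P * \<rho> (inv g)" for g
  define c :: complex where "c = 1 / of_nat (card (carrier G))"
  have card: "card (carrier G) > 0" using finite_carrier by (simp add: card_gt_0_iff) blast
  have c1: "c * of_nat (card (carrier G)) = 1" using card by (simp add: c_def)
  define S where "S = sum_mat d d F (carrier G)"
  define Q where "Q = c \<cdot>\<^sub>m S"
  note rc = rep_carrier[OF rep]
  have F: "F g \<in> carrier_mat d d" if "g \<in> carrier G" for g using that P(1) rc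
    by (auto simp: F_def intro!: mult_carrier_mat[of _ d d])
  have S: "S \<in> carrier_mat d d" by (simp add: S_def)
  have Q: "Q \<in> carrier_mat d d" by (simp add: Q_def S_def)
  \<comment> \<open>By invariance, each conjugate \<open>F g\<close> has its image inside that of
    \<open>P\<close> and fixes that image pointwise. Averaging gives \<open>P * Q = Q\<close> and
    \<open>Q * P = P\<close>, from which idempotence and nontriviality of \<open>Q\<close>
    follow.\<close>
  have PF: "P * F g = F g" if g: "g \<in> carrier G" for g
  proof -
    have "P * F g = (P * \<rho> g * P) * \<rho> (inv g)" using g P(1) rc[OF g] rc[of "inv g"] by (simp add: F_def)
    then show ?thesis by (simp only: inv[OF g] F_def)
  qed
  have FP: "F g * P = P" if g: "g \<in> carrier G" for g
  proof -
    have "F g * P = \<rho> g * (P * \<rho> (inv g) * P)" using g P(1) rc[OF g] rc[of "inv g"] by (simp add: F_def)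
    also have "\<dots> = (\<rho> g * \<rho> (inv g)) * P"
      unfolding inv[OF inv_closed[OF g]] using g P(1) rc[OF g] rc[of "inv g"] by simp
    finally show ?thesis unfolding rep_inv(1)[OF rep g] using P(1) by simp
  qed
  have PQ: "P * Q = Q"
  proof -
    have "P * S = S" unfolding S_def by (subst mult_sum_mat[OF P(1) F]) (auto intro: sum_mat_cong simp: PF)
    then show ?thesis using P(1) S by (simp add: Q_def mult_smult_distrib)
  qed
  have QP: "Q * P = P"
  proof -
    have "S * P = sum_mat d d (\<lambda>_. P) (carrier G)"
      unfolding S_def by (subst sum_mat_mult[OF P(1) F]) (auto intro: sum_mat_cong simp: FP)
    then have "S * P = of_nat (card (carrier G)) \<cdot>\<^sub>m P" by (simp add: sum_mat_const P(1))
    then have "Q * P = c \<cdot>\<^sub>m (of_nat (card (carrier G)) \<cdot>\<^sub>m P)"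
      using P(1) S by (simp add: Q_def mult_smult_assoc_mat)
    also have "\<dots> = P" using P(1) c1 by (intro eq_matI) (auto simp flip: mult.assoc)
    finally show ?thesis .
  qed
  have "Q * Q = Q * (P * Q)" by (simp add: PQ)
  also have "\<dots> = (Q * P) * Q" using Q P(1) by simp
  also have "\<dots> = Q" by (simp only: QP PQ)
  finally have QQ: "Q * Q = Q" .
  have "Q \<noteq> 0\<^sub>m d d" using QP P by auto
  moreover have "Q \<noteq> 1\<^sub>m d" using PQ P by auto
  moreover have "Q * \<rho> h = \<rho> h * Q" if h: "h \<in> carrier G" for h
  proof -
    \<comment> \<open>Commuting with \<open>\<rho> h\<close> amounts to shifting the summation index
      from \<open>g\<close> to \<open>h \<otimes> g\<close>.\<close>
    have Fh: "F (h \<otimes> g) * \<rho> h = \<rho> h * F g" if g: "g \<in> carrier G" for g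
    proof -
      have "\<rho> (inv (h \<otimes> g)) * \<rho> h = \<rho> (inv g)"
        using g h rep_mult[OF rep, of "inv (h \<otimes> g)" h] by (simp add: inv_mult_group m_assoc)
      then have "F (h \<otimes> g) * \<rho> h = \<rho> h * \<rho> g * P * \<rho> (inv g)"
        using g h P(1) rc[of "inv (h \<otimes> g)"] rc[of h] rc[of g] rc[of "inv g"]
        by (simp add: F_def rep_mult[OF rep])
      then show ?thesis using g h P(1) rc[of h] rc[of g] rc[of "inv g"] by (simp add: F_def)
    qed
    have "S * \<rho> h = sum_mat d d (\<lambda>g. F g * \<rho> h) (carrier G)"
      unfolding S_def by (rule sum_mat_mult[OF rc[OF h] F])
    also have "\<dots> = sum_mat d d (\<lambda>g. F (h \<otimes> g) * \<rho> h) (carrier G)"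
      by (rule sum_mat_reindex[OF bij_left_mult[OF h], symmetric])
    also have "\<dots> = sum_mat d d (\<lambda>g. \<rho> h * F g) (carrier G)"
      by (rule sum_mat_cong) (auto simp: Fh)
    also have "\<dots> = \<rho> h * S" unfolding S_def by (rule mult_sum_mat[OF rc[OF h] F, symmetric])
    finally show ?thesis using S rc[OF h] by (simp add: Q_def mult_smult_distrib mult_smult_assoc_mat)
  qed
  ultimately show thesis using that Q QQ by blast
qed

text \<open>Complete reducibility as an induction principle: a property passes from two summands to
  the whole, the summands being given by inclusions \<open>A\<close>, \<open>A'\<close> and
  projections \<open>B\<close>, \<open>B'\<close>. Dimension zero is a case of its own because
  irreducible representations have positive dimension.\<close>

lemma rep_induct [consumes 1, case_names zero irr sum]:
  assumes "is_rep G d \<rho>"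
    and zero: "\<And>\<rho>. is_rep G 0 \<rho> \<Longrightarrow> \<Phi> 0 \<rho>"
    and irr: "\<And>d \<rho>. irr_rep G d \<rho> \<Longrightarrow> \<Phi> d \<rho>"
    and sum: "\<And>d \<rho> r \<sigma> A B r' \<sigma>' A' B'.
      is_rep G d \<rho> \<Longrightarrow> is_rep G r \<sigma> \<Longrightarrow> is_rep G r' \<sigma>'
      \<Longrightarrow> intertwiner G r \<sigma> d \<rho> A \<Longrightarrow> intertwiner G d \<rho> r \<sigma> B
      \<Longrightarrow> intertwiner G r' \<sigma>' d \<rho> A' \<Longrightarrow> intertwiner G d \<rho> r' \<sigma>' B'
      \<Longrightarrow> A * B + A' * B' = 1\<^sub>m d \<Longrightarrow> \<Phi> r \<sigma> \<Longrightarrow> \<Phi> r' \<sigma>' \<Longrightarrow> \<Phi> d \<rho>"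
  shows "\<Phi> d \<rho>"
  using assms(1)
proof (induction d arbitrary: \<rho> rule: less_induct)
  case (less d)
  show ?case
  proof (cases "d = 0 \<or> irr_rep G d \<rho>")
    case True
    then show ?thesis using zero irr less.prems by auto
  next
    case False
    then obtain P where P: "P \<in> carrier_mat d d" "P \<noteq> 0\<^sub>m d d" "P \<noteq> 1\<^sub>m d" "P * P = P"
      "\<And>g. g \<in> carrier G \<Longrightarrow> P * \<rho> g * P = \<rho> g * P"
      using less.prems by (auto simp: irr_rep_def)
    obtain Q where Q: "Q \<in> carrier_mat d d" "Q * Q = Q" "Q \<noteq> 0\<^sub>m d d" "Q \<noteq> 1\<^sub>m d"
      "\<And>g. g \<in> carrier G \<Longrightarrow> Q * \<rho> g = \<rho> g * Q"
      using Maschke_idempotent[OF less.prems P] by metis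
    obtain r \<sigma> A B where 1: "r < d" "is_rep G r \<sigma>" "intertwiner G r \<sigma> d \<rho> A"
      "intertwiner G d \<rho> r \<sigma> B" "A * B = Q"
      using commuting_idempotent_split[OF less.prems Q(1,2,4,5)] by metis
    \<comment> \<open>The complementary idempotent also commutes with the action and cuts out the
      second summand.\<close>
    define Q' where "Q' = 1\<^sub>m d - Q"
    have Q': "Q' \<in> carrier_mat d d" unfolding Q'_def by (rule minus_carrier_mat[OF Q(1)])
    have add: "Q + Q' = 1\<^sub>m d" unfolding Q'_def using Q(1) by (intro eq_matI) auto
    have l: "Q' * M = M - Q * M" and r: "M * Q' = M - M * Q" if "M \<in> carrier_mat d d" for M
      unfolding Q'_def using minus_mult_distrib_mat[of "1\<^sub>m d" d d Q M d]
        mult_minus_distrib_mat[of M d d "1\<^sub>m d" d Q] that Q(1) by simp_all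
    have "Q' * Q' = Q'"
    proof -
      have "Q * Q' = 0\<^sub>m d d" using r[OF Q(1)] Q(1,2) by simp
      then show ?thesis using l[OF Q'] Q' by auto
    qed
    moreover have "Q' \<noteq> 1\<^sub>m d"
    proof
      assume "Q' = 1\<^sub>m d"
      then have "Q = 0\<^sub>m d d" using r[OF Q(1)] Q(1,2) by simp
      then show False using Q by simp
    qed
    moreover have "Q' * \<rho> g = \<rho> g * Q'" if "g \<in> carrier G" for g
      using l r Q(5) rep_carrier[OF less.prems] that by simp
    ultimately obtain r' \<sigma>' A' B' where 2: "r' < d" "is_rep G r' \<sigma>'" "intertwiner G r' \<sigma>' d \<rho> A'"
      "intertwiner G d \<rho> r' \<sigma>' B'" "A' * B' = Q'"
      using commuting_idempotent_split[OF less.prems Q'] by metis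
    show ?thesis
      using sum[OF less.prems 1(2) 2(2) 1(3,4) 2(3,4) _ less.IH[OF 1(1,2)] less.IH[OF 2(1,2)]]
        add 1(5) 2(5) by simp
  qed
qed

end

section \<open>The group ring and its reduced norms\<close>

context finite_group begin

lemma rep_ext_carrier [simp]: "rep_ext G d \<rho> f \<in> carrier_mat d d"
  by (simp add: rep_ext_def)

lemma rep_ext_sum_mat:
  assumes "is_rep G d \<rho>"
  shows "rep_ext G d \<rho> f = sum_mat d d (\<lambda>g. f g \<cdot>\<^sub>m \<rho> g) (carrier G)"
  unfolding rep_ext_def sum_mat_def
proof (rule cong_mat[OF refl refl], simp, rule sum.cong[OF refl])
  fix i j g assume "i < d" "j < d" "g \<in> carrier G"
  then show "f g * \<rho> g $$ (i, j) = (f g \<cdot>\<^sub>m \<rho> g) $$ (i, j)"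
    using rep_carrier[OF assms, of g] by simp
qed

lemma intertwiner_rep_ext:
  assumes C: "intertwiner G d \<rho> e \<sigma> C" and \<rho>: "is_rep G d \<rho>" and \<sigma>: "is_rep G e \<sigma>"
  shows "C * rep_ext G d \<rho> f = rep_ext G e \<sigma> f * C"
proof -
  note cC = intertwinerD(1)[OF C]
  have "C * rep_ext G d \<rho> f = sum_mat e d (\<lambda>g. C * (f g \<cdot>\<^sub>m \<rho> g)) (carrier G)"
    unfolding rep_ext_sum_mat[OF \<rho>] by (rule mult_sum_mat[OF cC]) (simp add: rep_carrier[OF \<rho>])
  also have "\<dots> = sum_mat e d (\<lambda>g. (f g \<cdot>\<^sub>m \<sigma> g) * C) (carrier G)"
  proof (rule sum_mat_cong[OF refl])
    fix g assume g: "g \<in> carrier G"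
    show "C * (f g \<cdot>\<^sub>m \<rho> g) = (f g \<cdot>\<^sub>m \<sigma> g) * C"
      using mult_smult_distrib[OF cC rep_carrier[OF \<rho> g]]
        mult_smult_assoc_mat[OF rep_carrier[OF \<sigma> g] cC] intertwinerD(2)[OF C g] by simp
  qed
  also have "\<dots> = rep_ext G e \<sigma> f * C"
    unfolding rep_ext_sum_mat[OF \<sigma>]
    by (rule sum_mat_mult[OF cC, symmetric]) (simp add: rep_carrier[OF \<sigma>])
  finally show ?thesis .
qed

text \<open>For fixed \<open>y\<close>, replacing \<open>x\<close> by \<open>y \<otimes> x\<close>
  separates the two factors of the convolution.\<close>

lemma rep_ext_mult:
  assumes rep: "is_rep G d \<rho>"
  shows "rep_ext G d \<rho> (grp_mult G f h) = rep_ext G d \<rho> f * rep_ext G d \<rho> h"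
proof (rule eq_matI)
  fix i j assume "i < dim_row (rep_ext G d \<rho> f * rep_ext G d \<rho> h)"
    "j < dim_col (rep_ext G d \<rho> f * rep_ext G d \<rho> h)"
  then have ij: "i < d" "j < d" by (auto simp: rep_ext_def)
  let ?G = "carrier G"
  have "rep_ext G d \<rho> (grp_mult G f h) $$ (i, j)
      = (\<Sum>x\<in>?G. \<Sum>y\<in>?G. f y * (h (inv y \<otimes> x) * \<rho> x $$ (i, j)))"
    using ij by (simp add: rep_ext_def grp_mult_def sum_distrib_right mult.assoc)
  also have "\<dots> = (\<Sum>y\<in>?G. f y * (\<Sum>x\<in>?G. h (inv y \<otimes> x) * \<rho> x $$ (i, j)))"
    by (subst sum.swap) (simp add: sum_distrib_left)
  also have "\<dots> = (\<Sum>y\<in>?G. f y * (\<Sum>x\<in>?G. h x * (\<Sum>k<d. \<rho> y $$ (i, k) * \<rho> x $$ (k, j))))"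
  proof (rule sum.cong[OF refl])
    fix y assume y: "y \<in> ?G"
    have "(\<Sum>x\<in>?G. h (inv y \<otimes> x) * \<rho> x $$ (i, j))
        = (\<Sum>x\<in>?G. h (inv y \<otimes> (y \<otimes> x)) * \<rho> (y \<otimes> x) $$ (i, j))"
      by (rule sum.reindex_bij_betw[OF bij_left_mult[OF y], symmetric])
    also have "\<dots> = (\<Sum>x\<in>?G. h x * (\<Sum>k<d. \<rho> y $$ (i, k) * \<rho> x $$ (k, j)))"
    proof (rule sum.cong[OF refl])
      fix x assume x: "x \<in> ?G"
      have "inv y \<otimes> (y \<otimes> x) = x" using x y by (simp flip: m_assoc)
      moreover have "\<rho> (y \<otimes> x) $$ (i, j) = (\<Sum>k<d. \<rho> y $$ (i, k) * \<rho> x $$ (k, j))"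
        using ij rep_carrier[OF rep x] rep_carrier[OF rep y]
        by (simp add: rep_mult[OF rep y x] scalar_prod_def atLeast0LessThan)
      ultimately show "h (inv y \<otimes> (y \<otimes> x)) * \<rho> (y \<otimes> x) $$ (i, j)
          = h x * (\<Sum>k<d. \<rho> y $$ (i, k) * \<rho> x $$ (k, j))" by simp
    qed
    finally show "f y * (\<Sum>x\<in>?G. h (inv y \<otimes> x) * \<rho> x $$ (i, j))
        = f y * (\<Sum>x\<in>?G. h x * (\<Sum>k<d. \<rho> y $$ (i, k) * \<rho> x $$ (k, j)))" by simp
  qed
  also have "\<dots> = (\<Sum>y\<in>?G. \<Sum>x\<in>?G. \<Sum>k<d. (f y * \<rho> y $$ (i, k)) * (h x * \<rho> x $$ (k, j)))"
    by (simp add: sum_distrib_left mult_ac)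
  also have "\<dots> = (\<Sum>y\<in>?G. \<Sum>k<d. \<Sum>x\<in>?G. (f y * \<rho> y $$ (i, k)) * (h x * \<rho> x $$ (k, j)))"
    by (rule sum.cong[OF refl], rule sum.swap)
  also have "\<dots> = (\<Sum>k<d. \<Sum>y\<in>?G. \<Sum>x\<in>?G. (f y * \<rho> y $$ (i, k)) * (h x * \<rho> x $$ (k, j)))"
    by (rule sum.swap)
  also have "\<dots> = (\<Sum>k<d. (\<Sum>y\<in>?G. f y * \<rho> y $$ (i, k)) * (\<Sum>x\<in>?G. h x * \<rho> x $$ (k, j)))"
    by (simp add: sum_product)
  also have "\<dots> = (rep_ext G d \<rho> f * rep_ext G d \<rho> h) $$ (i, j)"
    using ij by (simp add: rep_ext_def scalar_prod_def atLeast0LessThan)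
  finally show "rep_ext G d \<rho> (grp_mult G f h) $$ (i, j)
      = (rep_ext G d \<rho> f * rep_ext G d \<rho> h) $$ (i, j)" .
qed (auto simp: rep_ext_def)

text \<open>\<open>ind {x}\<close> is the group element \<open>x\<close> in the group ring, and
  \<open>ind S\<close> is the sum of the elements of \<open>S\<close>.\<close>

definition ind :: "'a set \<Rightarrow> 'a \<Rightarrow> complex" where
  "ind S = (\<lambda>g. if g \<in> S then 1 else 0)"

lemma ind_grp_ring: "S \<subseteq> carrier G \<Longrightarrow> ind S \<in> grp_ring G \<int>"
  by (auto simp: ind_def grp_ring_def)

lemma grp_ring_mono: "f \<in> grp_ring G S \<Longrightarrow> f \<in> grp_ring G UNIV"
  by (auto simp: grp_ring_def)

lemma rep_ext_ind:
  assumes "S \<subseteq> carrier G"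
  shows "rep_ext G d \<rho> (ind S) = sum_mat d d \<rho> S"
  unfolding rep_ext_def sum_mat_def
proof (rule cong_mat[OF refl refl], simp)
  fix i j
  have "(\<Sum>g\<in>carrier G. ind S g * \<rho> g $$ (i, j)) = (\<Sum>g\<in>S. ind S g * \<rho> g $$ (i, j))"
    using assms by (intro sum.mono_neutral_right finite_carrier) (auto simp: ind_def)
  then show "(\<Sum>g\<in>carrier G. ind S g * \<rho> g $$ (i, j)) = (\<Sum>g\<in>S. \<rho> g $$ (i, j))"
    by (simp add: ind_def)
qed

lemma rep_ext_ind_single:
  assumes "is_rep G d \<rho>" "x \<in> carrier G"
  shows "rep_ext G d \<rho> (ind {x}) = \<rho> x"
  using assms rep_carrier[OF assms] by (subst rep_ext_ind) (auto simp: sum_mat_def intro!: eq_matI)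

lemma grp_mult_ind_single_left:
  assumes "x \<in> carrier G" "y \<in> carrier G"
  shows "grp_mult G (ind {x}) f y = f (inv x \<otimes> y)"
proof -
  have "grp_mult G (ind {x}) f y = (\<Sum>t\<in>carrier G. if t = x then f (inv t \<otimes> y) else 0)"
    using assms by (auto simp: grp_mult_def ind_def intro!: sum.cong)
  then show ?thesis using assms finite_carrier by simp
qed

lemma grp_mult_ind_single_right:
  assumes "x \<in> carrier G" "y \<in> carrier G"
  shows "grp_mult G f (ind {x}) y = f (y \<otimes> inv x)"
proof -
  have "inv t \<otimes> y = x \<longleftrightarrow> t = y \<otimes> inv x" if "t \<in> carrier G" for t
  proof
    assume "inv t \<otimes> y = x"
    then have "y = t \<otimes> x" using assms that by (metis inv_solve_left)
    then show "t = y \<otimes> inv x" using assms that by (simp add: m_assoc)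
  next
    assume "t = y \<otimes> inv x"
    then show "inv t \<otimes> y = x" using assms by (simp add: inv_mult_group m_assoc)
  qed
  then have "grp_mult G f (ind {x}) y = (\<Sum>t\<in>carrier G. if t = y \<otimes> inv x then f t else 0)"
    using assms by (auto simp: grp_mult_def ind_def intro!: sum.cong)
  then show ?thesis using assms finite_carrier by simp
qed

lemma grp_mult_one_left:
  assumes "f \<in> grp_ring G S" shows "grp_mult G (ind {\<one>}) f = f"
proof
  fix y show "grp_mult G (ind {\<one>}) f y = f y"
    using assms grp_mult_ind_single_left[of \<one> y f]
    by (cases "y \<in> carrier G") (auto simp: grp_mult_def grp_ring_def)
qed

lemma grp_mult_one_right:
  assumes "f \<in> grp_ring G S" shows "grp_mult G f (ind {\<one>}) = f"
proof
  fix y show "grp_mult G f (ind {\<one>}) y = f y"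
    using assms grp_mult_ind_single_right[of \<one> y f]
    by (cases "y \<in> carrier G") (auto simp: grp_mult_def grp_ring_def)
qed

lemma grp_mult_grp_ring_UNIV: "grp_mult G f h \<in> grp_ring G UNIV"
  by (simp add: grp_mult_def grp_ring_def)

lemma grp_mult_grp_ring_Ints:
  assumes "f \<in> grp_ring G \<int>" "h \<in> grp_ring G \<int>" shows "grp_mult G f h \<in> grp_ring G \<int>"
  using assms by (auto simp: grp_mult_def grp_ring_def intro!: Ints_sum Ints_mult)

section \<open>The regular representation and the existence of reduced norms\<close>

text \<open>This is left multiplication on the basis \<open>e\<close>. The position \<open>j\<close>
  of the identity is recorded because column \<open>j\<close> of the image of a group ring element
  lists its coefficients.\<close>

lemma regular_rep:
  obtains n \<rho> j and e :: "nat \<Rightarrow> 'a" where "is_rep G n \<rho>" "bij_betw e {..<n} (carrier G)" "j < n" "e j = \<one>"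
    "\<And>g i k. g \<in> carrier G \<Longrightarrow> i < n \<Longrightarrow> k < n \<Longrightarrow>
      \<rho> g $$ (i, k) = (if e i = g \<otimes> e k then 1 else 0)"
proof -
  define n where "n = card (carrier G)"
  obtain e where e: "bij_betw e {..<n} (carrier G)"
    using ex_bij_betw_nat_finite[OF finite_carrier] by (auto simp: n_def atLeast0LessThan)
  have ec: "e i \<in> carrier G" if "i < n" for i using e that by (auto simp: bij_betw_def)
  obtain j where j: "j < n" "e j = \<one>" using e one_closed
    by (metis bij_betw_imp_surj_on imageE lessThan_iff)
  define \<rho> where "\<rho> g = mat n n (\<lambda>(i, k). if e i = g \<otimes> e k then 1 else 0 :: complex)" for g
  have "is_rep G n \<rho>" unfolding is_rep_def
  proof (intro conjI ballI)
    show "\<rho> g \<in> carrier_mat n n" for g by (simp add: \<rho>_def)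
    show "\<rho> \<one> = 1\<^sub>m n"
      using e ec by (intro eq_matI) (auto simp: \<rho>_def bij_betw_def inj_on_def)
    fix g h assume g: "g \<in> carrier G" and h: "h \<in> carrier G"
    show "\<rho> (g \<otimes> h) = \<rho> g * \<rho> h"
    proof (rule eq_matI)
      fix i k assume "i < dim_row (\<rho> g * \<rho> h)" "k < dim_col (\<rho> g * \<rho> h)"
      then have ik: "i < n" "k < n" by (auto simp: \<rho>_def)
      have "(\<rho> g * \<rho> h) $$ (i, k)
          = (\<Sum>l<n. (if e i = g \<otimes> e l then 1 else 0) * (if e l = h \<otimes> e k then 1 else 0))"
        using ik by (simp add: \<rho>_def scalar_prod_def atLeast0LessThan)
      also have "\<dots> = (\<Sum>y\<in>carrier G. (if e i = g \<otimes> y then 1 else 0) * (if y = h \<otimes> e k then 1 else 0))"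
        by (rule sum.reindex_bij_betw[OF e])
      also have "\<dots> = (\<Sum>y\<in>carrier G. if y = h \<otimes> e k then (if e i = g \<otimes> y then 1 else 0) else 0)"
        by (rule sum.cong) auto
      also have "\<dots> = \<rho> (g \<otimes> h) $$ (i, k)"
        using ik ec g h finite_carrier by (simp add: \<rho>_def m_assoc)
      finally show "\<rho> (g \<otimes> h) $$ (i, k) = (\<rho> g * \<rho> h) $$ (i, k)" by simp
    qed (auto simp: \<rho>_def)
  qed
  then show thesis by (rule that[OF _ e j]) (simp add: \<rho>_def)
qed

text \<open>By complete reducibility, agreement in irreducible representations spreads to every
  representation, in particular to the regular one, which shows all coefficients. This gives the
  uniqueness behind \<open>THE\<close> in \<open>red_norm\<close>.\<close>

lemma irr_reps_separate:
  assumes f: "f \<in> grp_ring G UNIV" and h: "h \<in> grp_ring G UNIV"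
    and eq: "\<And>d \<rho>. irr_rep G d \<rho> \<Longrightarrow> rep_ext G d \<rho> f = rep_ext G d \<rho> h"
  shows "f = h"
proof -
  have all: "rep_ext G d \<rho> f = rep_ext G d \<rho> h" if "is_rep G d \<rho>" for d \<rho>
    using that
  proof (induction rule: rep_induct)
    case (zero \<rho>)
    show ?case by (intro eq_matI) (auto simp: rep_ext_def)
  next
    case (irr d \<rho>)
    then show ?case by (rule eq)
  next
    case (sum d \<rho> r \<sigma> A B r' \<sigma>' A' B')
    \<comment> \<open>Insert \<open>A * B + A' * B' = 1\<close> on the right and move the inclusions
      \<open>A\<close> and \<open>A'\<close> past the group ring element.\<close>
    have "rep_ext G d \<rho> u = A * rep_ext G r \<sigma> u * B + A' * rep_ext G r' \<sigma>' u * B'" for u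
    proof -
      note c = intertwinerD(1)[OF sum(4)] intertwinerD(1)[OF sum(5)]
        intertwinerD(1)[OF sum(6)] intertwinerD(1)[OF sum(7)]
      have "rep_ext G d \<rho> u = rep_ext G d \<rho> u * (A * B + A' * B')"
        unfolding sum(8) by (rule right_mult_one_mat[OF rep_ext_carrier, symmetric])
      also have "\<dots> = rep_ext G d \<rho> u * (A * B) + rep_ext G d \<rho> u * (A' * B')"
        by (rule mult_add_distrib_mat[of _ d d _ d]) (use c in auto)
      also have "rep_ext G d \<rho> u * (A * B) = rep_ext G d \<rho> u * A * B"
        by (rule assoc_mult_mat[OF rep_ext_carrier c(1,2), symmetric])
      also have "rep_ext G d \<rho> u * (A' * B') = rep_ext G d \<rho> u * A' * B'"
        by (rule assoc_mult_mat[OF rep_ext_carrier c(3,4), symmetric])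
      finally show ?thesis
        by (simp only: intertwiner_rep_ext[OF sum(4,2,1)] intertwiner_rep_ext[OF sum(6,3,1)])
    qed
    then show ?case by (simp add: sum)
  qed
  obtain n \<rho> j e where reg: "is_rep G n \<rho>" "bij_betw e {..<n} (carrier G)" "j < n" "e j = \<one>"
    "\<And>g i k. g \<in> carrier G \<Longrightarrow> i < n \<Longrightarrow> k < n \<Longrightarrow>
      \<rho> g $$ (i, k) = (if e i = g \<otimes> e k then 1 else 0)"
    using regular_rep by metis
  have "u (e i) = rep_ext G n \<rho> u $$ (i, j)" if "i < n" for u i
  proof -
    have "e i \<in> carrier G" using reg(2) that by (auto simp: bij_betw_def)
    have "rep_ext G n \<rho> u $$ (i, j) = (\<Sum>g\<in>carrier G. if g = e i then u g else 0)"
      using that reg(3-5) by (auto simp: rep_ext_def intro!: sum.cong)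
    then show ?thesis using finite_carrier \<open>e i \<in> carrier G\<close> by simp
  qed
  then have "f (e i) = h (e i)" if "i < n" for i using that all[OF reg(1)] by metis
  then have "f g = h g" if "g \<in> carrier G" for g
    using reg(2) that by (metis bij_betw_imp_surj_on imageE lessThan_iff)
  moreover have "f g = h g" if "g \<notin> carrier G" for g
    using that f h by (simp add: grp_ring_def)
  ultimately show ?thesis by blast
qed

lemma red_norm_eqI:
  assumes "z \<in> grp_ring G UNIV"
    and "\<And>d \<rho>. irr_rep G d \<rho> \<Longrightarrow> rep_ext G d \<rho> z = det (rep_blk G d \<rho> n H) \<cdot>\<^sub>m 1\<^sub>m d"
  shows "red_norm G n H = z"
  unfolding red_norm_def
  by (rule the_equality) (use assms in \<open>auto intro: irr_reps_separate\<close>)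

text \<open>\<open>T\<close> acts on each irreducible constituent by the determinant of
  \<open>h\<close> there. Testing \<open>T\<close> against all intertwiners \<open>C\<close> into
  irreducible representations makes this independent of any chosen decomposition, so it can be
  proved with \<open>rep_induct\<close>.\<close>

lemma rep_scalar_operator:
  assumes "is_rep G d \<rho>"
  shows "\<exists>T \<in> carrier_mat d d. \<forall>e \<sigma> C. irr_rep G e \<sigma> \<longrightarrow> intertwiner G d \<rho> e \<sigma> C
    \<longrightarrow> C * T = det (rep_ext G e \<sigma> h) \<cdot>\<^sub>m C"
  using assms
proof (induction rule: rep_induct)
  case (zero \<rho>)
  show ?case by (intro bexI[of _ "0\<^sub>m 0 0"] allI impI eq_matI) (auto simp: intertwiner_def)
next
  case (irr d \<rho>)
  show ?case
  proof (intro bexI[of _ "det (rep_ext G d \<rho> h) \<cdot>\<^sub>m 1\<^sub>m d"] allI impI)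
    fix e \<sigma> C assume \<sigma>: "irr_rep G e \<sigma>" and C: "intertwiner G d \<rho> e \<sigma> C"
    note cC = intertwinerD(1)[OF C]
    have "C * (det (rep_ext G d \<rho> h) \<cdot>\<^sub>m 1\<^sub>m d) = det (rep_ext G d \<rho> h) \<cdot>\<^sub>m C"
      using mult_smult_distrib[OF cC one_carrier_mat] cC by simp
    also have "\<dots> = det (rep_ext G e \<sigma> h) \<cdot>\<^sub>m C"
    \<comment> \<open>A nonzero intertwiner between irreducible representations is invertible, so
      \<open>h\<close> has the same determinant in both.\<close>
    proof (cases "C = 0\<^sub>m e d")
      case False
      note S = Schur_lemma[OF irr \<sigma> C False]
      have "det (C * rep_ext G d \<rho> h) = det (rep_ext G e \<sigma> h * C)"
        by (simp only: intertwiner_rep_ext[OF C irr_repD(2)[OF irr] irr_repD(2)[OF \<sigma>]])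
      then have "det C * det (rep_ext G d \<rho> h) = det (rep_ext G e \<sigma> h) * det C"
        using det_mult[of C d "rep_ext G d \<rho> h"] det_mult[of "rep_ext G e \<sigma> h" e C] cC S(1) by simp
      then show ?thesis using S(2) by simp
    qed (auto intro!: eq_matI)
    finally show "C * (det (rep_ext G d \<rho> h) \<cdot>\<^sub>m 1\<^sub>m d) = det (rep_ext G e \<sigma> h) \<cdot>\<^sub>m C" .
  qed simp
next
  case (sum d \<rho> r \<sigma> A B r' \<sigma>' A' B')
  obtain T T' where T: "T \<in> carrier_mat r r" "T' \<in> carrier_mat r' r'"
    "\<And>e \<tau> C. irr_rep G e \<tau> \<Longrightarrow> intertwiner G r \<sigma> e \<tau> C \<Longrightarrow> C * T = det (rep_ext G e \<tau> h) \<cdot>\<^sub>m C"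
    "\<And>e \<tau> C. irr_rep G e \<tau> \<Longrightarrow> intertwiner G r' \<sigma>' e \<tau> C \<Longrightarrow> C * T' = det (rep_ext G e \<tau> h) \<cdot>\<^sub>m C"
    using sum(9,10) by blast
  note c = intertwinerD(1)[OF sum(4)] intertwinerD(1)[OF sum(5)]
    intertwinerD(1)[OF sum(6)] intertwinerD(1)[OF sum(7)]
  have cT: "A * T * B \<in> carrier_mat d d" "A' * T' * B' \<in> carrier_mat d d" using c T by auto
  show ?case
  \<comment> \<open>The operators of the summands act side by side. They apply because
    \<open>C * A\<close> and \<open>C * A'\<close> are intertwiners out of the summands.\<close>
  proof (intro bexI[of _ "A * T * B + A' * T' * B'"] allI impI)
    fix e \<tau> C assume \<tau>: "irr_rep G e \<tau>" and C: "intertwiner G d \<rho> e \<tau> C"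
    note cC = intertwinerD(1)[OF C]
    define \<delta> where "\<delta> = det (rep_ext G e \<tau> h)"
    have 1: "C * A * T = \<delta> \<cdot>\<^sub>m (C * A)" unfolding \<delta>_def
      by (rule T(3)[OF \<tau> intertwiner_comp[OF sum(4) C sum(2,1) irr_repD(2)[OF \<tau>]]])
    have 2: "C * A' * T' = \<delta> \<cdot>\<^sub>m (C * A')" unfolding \<delta>_def
      by (rule T(4)[OF \<tau> intertwiner_comp[OF sum(6) C sum(3,1) irr_repD(2)[OF \<tau>]]])
    have "C * (A * T * B + A' * T' * B') = C * (A * T * B) + C * (A' * T' * B')"
      by (rule mult_add_distrib_mat[OF cC cT])
    also have "C * (A * T * B) = (C * A * T) * B" using c T(1) cC by simp
    also have "\<dots> = \<delta> \<cdot>\<^sub>m (C * (A * B))"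
      unfolding 1 using c cC mult_smult_assoc_mat[of "C * A" e r B d \<delta>] by simp
    also have "C * (A' * T' * B') = (C * A' * T') * B'" using c T(2) cC by simp
    also have "\<dots> = \<delta> \<cdot>\<^sub>m (C * (A' * B'))"
      unfolding 2 using c cC mult_smult_assoc_mat[of "C * A'" e r' B' d \<delta>] by simp
    also have "\<delta> \<cdot>\<^sub>m (C * (A * B)) + \<delta> \<cdot>\<^sub>m (C * (A' * B')) = \<delta> \<cdot>\<^sub>m (C * (A * B) + C * (A' * B'))"
      by (rule add_smult_distrib_left_mat[symmetric, of _ e d]) (use c cC in auto)
    also have "C * (A * B) + C * (A' * B') = C * (A * B + A' * B')"
      by (rule mult_add_distrib_mat[symmetric, OF cC, of _ d]) (use c in auto)
    also have "\<dots> = C" unfolding sum(8) using cC by simp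
    finally show "C * (A * T * B + A' * T' * B') = det (rep_ext G e \<tau> h) \<cdot>\<^sub>m C"
      by (simp only: \<delta>_def)
  qed (use cT in auto)
qed

text \<open>Applying the operator \<open>T\<close> of the regular representation to the basis vector
  of the identity produces a group ring element with the prescribed scalars.\<close>

lemma det_scalars_realised:
  "\<exists>z \<in> grp_ring G UNIV. \<forall>d \<rho>. irr_rep G d \<rho> \<longrightarrow>
    rep_ext G d \<rho> z = det (rep_ext G d \<rho> h) \<cdot>\<^sub>m 1\<^sub>m d"
proof -
  obtain n \<rho> j e where reg: "is_rep G n \<rho>" "bij_betw e {..<n} (carrier G)" "j < n" "e j = \<one>"
    "\<And>g i k. g \<in> carrier G \<Longrightarrow> i < n \<Longrightarrow> k < n \<Longrightarrow>
      \<rho> g $$ (i, k) = (if e i = g \<otimes> e k then 1 else 0)"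
    using regular_rep by metis
  have ec: "e i \<in> carrier G" if "i < n" for i using reg(2) that by (auto simp: bij_betw_def)
  obtain T where T: "T \<in> carrier_mat n n"
    "\<And>d \<sigma> C. irr_rep G d \<sigma> \<Longrightarrow> intertwiner G n \<rho> d \<sigma> C \<Longrightarrow> C * T = det (rep_ext G d \<sigma> h) \<cdot>\<^sub>m C"
    using rep_scalar_operator[OF reg(1)] by blast
  \<comment> \<open>The coefficients of \<open>z\<close> are column \<open>j\<close> of
    \<open>T\<close>, where \<open>j\<close> is the position of the identity.\<close>
  define z where "z g = (if g \<in> carrier G then T $$ (the_inv_into {..<n} e g, j) else 0)" for g
  have ze: "z (e k) = T $$ (k, j)" if "k < n" for k
    using that reg(2) ec by (simp add: z_def bij_betw_def the_inv_into_f_f)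
  have "rep_ext G d \<sigma> z = det (rep_ext G d \<sigma> h) \<cdot>\<^sub>m 1\<^sub>m d" if \<sigma>: "irr_rep G d \<sigma>" for d \<sigma>
  proof (rule eq_matI)
    note rep = irr_repD(2)[OF \<sigma>]
    fix i a assume "i < dim_row (det (rep_ext G d \<sigma> h) \<cdot>\<^sub>m 1\<^sub>m d)" "a < dim_col (det (rep_ext G d \<sigma> h) \<cdot>\<^sub>m 1\<^sub>m d)"
    then have ia: "i < d" "a < d" by auto
    \<comment> \<open>\<open>C\<close> sends the basis vector of \<open>g\<close> to column
      \<open>a\<close> of \<open>\<sigma> g\<close>, an intertwiner from the regular representation.
      Column \<open>j\<close> of \<open>C * T\<close> is therefore column \<open>a\<close> of
      \<sigma> at \<open>z\<close>, while column \<open>j\<close> of \<open>C\<close> is column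
      \<open>a\<close> of the identity.\<close>
    define C where "C = mat d n (\<lambda>(i, k). \<sigma> (e k) $$ (i, a))"
    have "intertwiner G n \<rho> d \<sigma> C" unfolding intertwiner_def
    proof (intro conjI ballI)
      show "C \<in> carrier_mat d n" by (simp add: C_def)
      fix g assume g: "g \<in> carrier G"
      show "C * \<rho> g = \<sigma> g * C"
      proof (rule eq_matI)
        note sc = rep_carrier[OF rep]
        fix l m assume "l < dim_row (\<sigma> g * C)" "m < dim_col (\<sigma> g * C)"
        then have lm: "l < d" "m < n" using sc[OF g] by (auto simp: C_def)
        have "(C * \<rho> g) $$ (l, m) = (\<Sum>k<n. \<sigma> (e k) $$ (l, a) * (if e k = g \<otimes> e m then 1 else 0))"
          using lm rep_carrier[OF reg(1) g]
          by (simp add: C_def scalar_prod_def atLeast0LessThan reg(5)[OF g] cong: sum.cong_simp)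
        also have "\<dots> = (\<Sum>y\<in>carrier G. \<sigma> y $$ (l, a) * (if y = g \<otimes> e m then 1 else 0))"
          by (rule sum.reindex_bij_betw[OF reg(2)])
        also have "\<dots> = (\<Sum>y\<in>carrier G. if y = g \<otimes> e m then \<sigma> y $$ (l, a) else 0)"
          by (rule sum.cong) auto
        also have "\<dots> = \<sigma> (g \<otimes> e m) $$ (l, a)" using finite_carrier g ec lm by simp
        also have "\<dots> = (\<Sum>k<d. \<sigma> g $$ (l, k) * \<sigma> (e m) $$ (k, a))"
          using lm ia sc[OF g] sc[OF ec[OF lm(2)]]
          by (simp add: rep_mult[OF rep g ec[OF lm(2)]] scalar_prod_def atLeast0LessThan)
        also have "\<dots> = (\<sigma> g * C) $$ (l, m)"
          using lm sc[OF g] by (simp add: C_def scalar_prod_def atLeast0LessThan)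
        finally show "(C * \<rho> g) $$ (l, m) = (\<sigma> g * C) $$ (l, m)" .
      qed (use rep_carrier[OF reg(1) g] rep_carrier[OF rep g] in \<open>auto simp: C_def\<close>)
    qed
    then have CT: "C * T = det (rep_ext G d \<sigma> h) \<cdot>\<^sub>m C" by (rule T(2)[OF \<sigma>])
    have "rep_ext G d \<sigma> z $$ (i, a) = (\<Sum>k<n. z (e k) * \<sigma> (e k) $$ (i, a))"
      using ia by (simp add: rep_ext_def sum.reindex_bij_betw[OF reg(2), symmetric])
    also have "\<dots> = (C * T) $$ (i, j)"
      using ia reg(3) T(1)
      by (simp add: C_def scalar_prod_def atLeast0LessThan ze mult.commute cong: sum.cong_simp)
    also have "\<dots> = (det (rep_ext G d \<sigma> h) \<cdot>\<^sub>m 1\<^sub>m d) $$ (i, a)"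
      unfolding CT using ia reg(3,4) rep_one[OF rep] by (simp add: C_def)
    finally show "rep_ext G d \<sigma> z $$ (i, a) = (det (rep_ext G d \<sigma> h) \<cdot>\<^sub>m 1\<^sub>m d) $$ (i, a)" .
  qed (auto simp: rep_ext_def)
  moreover have "z \<in> grp_ring G UNIV" by (simp add: z_def grp_ring_def)
  ultimately show ?thesis by blast
qed

lemma rep_blk_one: "rep_blk G d \<rho> 1 H = rep_ext G d \<rho> (H 0 0)"
  by (rule eq_matI) (auto simp: rep_blk_def rep_ext_def)

text \<open>Existence and uniqueness together show that the description in \<open>red_norm\<close>
  is proper for 1 x 1 matrices, the case used to prove \<open>G\<close> abelian.\<close>

lemma red_norm_single:
  shows red_norm_single_grp_ring: "red_norm G 1 (\<lambda>_ _. h) \<in> grp_ring G UNIV"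
    and rep_ext_red_norm_single: "irr_rep G d \<rho> \<Longrightarrow>
      rep_ext G d \<rho> (red_norm G 1 (\<lambda>_ _. h)) = det (rep_ext G d \<rho> h) \<cdot>\<^sub>m 1\<^sub>m d"
proof -
  obtain z where z: "z \<in> grp_ring G UNIV"
    "\<And>d \<rho>. irr_rep G d \<rho> \<Longrightarrow> rep_ext G d \<rho> z = det (rep_ext G d \<rho> h) \<cdot>\<^sub>m 1\<^sub>m d"
    using det_scalars_realised[of h] by blast
  have "red_norm G 1 (\<lambda>_ _. h) = z"
    by (rule red_norm_eqI[OF z(1)]) (simp only: rep_blk_one z(2))
  then show "red_norm G 1 (\<lambda>_ _. h) \<in> grp_ring G UNIV"
    "irr_rep G d \<rho> \<Longrightarrow> rep_ext G d \<rho> (red_norm G 1 (\<lambda>_ _. h)) = det (rep_ext G d \<rho> h) \<cdot>\<^sub>m 1\<^sub>m d"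
    using z by auto
qed

end

section \<open>Sums over subgroups\<close>

context finite_group begin

text \<open>If \<open>k\<close> is an eigenvalue of \<open>\<rho> g\<close>, then
  \<open>\<rho> g - k\<close> is a singular intertwiner, hence zero by Schur's lemma. So every
  \<open>\<rho> g\<close> is scalar, and every subspace is invariant.\<close>

lemma irr_commuting_dim_one:
  assumes irr: "irr_rep G d \<rho>"
    and comm: "\<And>g h. g \<in> carrier G \<Longrightarrow> h \<in> carrier G \<Longrightarrow> \<rho> g * \<rho> h = \<rho> h * \<rho> g"
  shows "d = 1"
proof (rule ccontr)
  assume "d \<noteq> 1"
  then have d: "d > 1" using irr_repD(1)[OF irr] by simp
  note rep = irr_repD(2)[OF irr]
  have scalar: "\<exists>k. \<rho> g = k \<cdot>\<^sub>m 1\<^sub>m d" if g: "g \<in> carrier G" for g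
  proof -
    note cg = rep_carrier[OF rep g]
    obtain k where "eigenvalue (\<rho> g) k"
      using spectrum_non_empty[OF cg] d by (auto simp: spectrum_def)
    then have det: "det (char_matrix (\<rho> g) k) = 0" by (simp add: eigenvalue_det[OF cg])
    have cm: "char_matrix (\<rho> g) k = \<rho> g + (- k) \<cdot>\<^sub>m 1\<^sub>m d" using cg by (simp add: char_matrix_def)
    have "intertwiner G d \<rho> d \<rho> (char_matrix (\<rho> g) k)" unfolding intertwiner_def
    proof (intro conjI ballI)
      show "char_matrix (\<rho> g) k \<in> carrier_mat d d" using cg by simp
      fix h assume h: "h \<in> carrier G"
      note ch = rep_carrier[OF rep h]
      have "char_matrix (\<rho> g) k * \<rho> h = \<rho> g * \<rho> h + ((- k) \<cdot>\<^sub>m 1\<^sub>m d) * \<rho> h"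
        unfolding cm by (rule add_mult_distrib_mat[OF cg _ ch]) simp
      also have "\<dots> = \<rho> h * \<rho> g + \<rho> h * ((- k) \<cdot>\<^sub>m 1\<^sub>m d)"
        using comm[OF g h] mult_smult_assoc_mat[OF one_carrier_mat ch, of "- k"]
          mult_smult_distrib[OF ch one_carrier_mat, of "- k"] ch by simp
      also have "\<dots> = \<rho> h * char_matrix (\<rho> g) k"
        unfolding cm by (rule mult_add_distrib_mat[OF ch cg, symmetric]) simp
      finally show "char_matrix (\<rho> g) k * \<rho> h = \<rho> h * char_matrix (\<rho> g) k" .
    qed
    then have "char_matrix (\<rho> g) k = 0\<^sub>m d d" using Schur_lemma(2)[OF irr irr] det by blast
    then have z: "\<rho> g + (- k) \<cdot>\<^sub>m 1\<^sub>m d = 0\<^sub>m d d" by (simp add: cm)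
    have "\<rho> g = k \<cdot>\<^sub>m 1\<^sub>m d"
    proof (rule eq_matI)
      fix i j assume "i < dim_row (k \<cdot>\<^sub>m 1\<^sub>m d)" "j < dim_col (k \<cdot>\<^sub>m 1\<^sub>m d)"
      then have ij: "i < d" "j < d" by auto
      have "(\<rho> g + (- k) \<cdot>\<^sub>m 1\<^sub>m d) $$ (i, j) = 0" using ij by (simp add: z)
      then show "\<rho> g $$ (i, j) = (k \<cdot>\<^sub>m 1\<^sub>m d) $$ (i, j)"
        using ij cg by (auto split: if_splits)
    qed (use cg in auto)
    then show ?thesis by blast
  qed
  \<comment> \<open>The projection onto the first coordinate axis, a proper invariant subspace once
    \<open>d > 1\<close>.\<close>
  define P :: "complex mat" where "P = mat d d (\<lambda>(i, j). if i = 0 \<and> j = 0 then 1 else 0)"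
  have P: "P \<in> carrier_mat d d" by (simp add: P_def)
  have PP: "P * P = P"
  proof (rule eq_matI)
    fix i j assume "i < dim_row P" "j < dim_col P"
    then have ij: "i < d" "j < d" by (auto simp: P_def)
    have "(P * P) $$ (i, j) = (\<Sum>l<d. (if i = 0 \<and> l = 0 then 1 else 0) * (if l = 0 \<and> j = 0 then 1 else 0))"
      using ij by (simp add: P_def scalar_prod_def atLeast0LessThan)
    also have "\<dots> = (\<Sum>l<d. if l = 0 then (if i = 0 \<and> j = 0 then 1 else 0) else 0)"
      by (rule sum.cong) auto
    also have "\<dots> = P $$ (i, j)" using ij d by (simp add: P_def)
    finally show "(P * P) $$ (i, j) = P $$ (i, j)" .
  qed (auto simp: P_def)
  have "P * \<rho> g * P = \<rho> g * P" if g: "g \<in> carrier G" for g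
  proof -
    obtain k where k: "\<rho> g = k \<cdot>\<^sub>m 1\<^sub>m d" using scalar[OF g] by blast
    have "P * \<rho> g = k \<cdot>\<^sub>m P" unfolding k using mult_smult_distrib[OF P one_carrier_mat] P by simp
    moreover have "\<rho> g * P = k \<cdot>\<^sub>m P"
      unfolding k using mult_smult_assoc_mat[OF one_carrier_mat P] P by simp
    moreover have "(k \<cdot>\<^sub>m P) * P = k \<cdot>\<^sub>m P" using mult_smult_assoc_mat[OF P P] PP by simp
    ultimately show ?thesis by simp
  qed
  then have "P = 0\<^sub>m d d \<or> P = 1\<^sub>m d" by (rule irr_repD(3)[OF irr P PP])
  moreover have "P $$ (0, 0) = 1" "P $$ (1, 1) = 0" using d by (auto simp: P_def)
  ultimately show False using d by auto
qed

lemma subgroup_sum_absorbs: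
  assumes rep: "is_rep G d \<rho>" and S: "subgroup S G" "s \<in> S"
  shows "\<rho> s * sum_mat d d \<rho> S = sum_mat d d \<rho> S"
proof -
  interpret S: subgroup S G by (rule S(1))
  have bij: "bij_betw (\<lambda>g. s \<otimes> g) S S"
    by (rule bij_betw_byWitness[where f' = "\<lambda>g. inv s \<otimes> g"]) (use S in \<open>auto simp flip: m_assoc\<close>)
  have "\<rho> s * sum_mat d d \<rho> S = sum_mat d d (\<lambda>g. \<rho> s * \<rho> g) S"
    using S by (intro mult_sum_mat) (auto intro: rep_carrier[OF rep])
  also have "\<dots> = sum_mat d d (\<lambda>g. \<rho> (s \<otimes> g)) S"
    using S by (intro sum_mat_cong) (auto simp: rep_mult[OF rep])
  also have "\<dots> = sum_mat d d \<rho> S" by (rule sum_mat_reindex[OF bij])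
  finally show ?thesis .
qed

text \<open>The sum over \<open>S\<close> absorbs \<open>\<rho> s\<close> and can be cancelled when
  it is invertible. Read backwards: if \<open>S\<close> acts nontrivially, its sum is
  singular.\<close>

lemma subgroup_sum_nonsingular:
  assumes rep: "is_rep G d \<rho>" and S: "subgroup S G" "s \<in> S" and det: "det (sum_mat d d \<rho> S) \<noteq> 0"
  shows "\<rho> s = 1\<^sub>m d"
proof -
  have s: "s \<in> carrier G" using S subgroup.subset by blast
  define X where "X = sum_mat d d \<rho> S"
  have X: "X \<in> carrier_mat d d" by (simp add: X_def)
  obtain Y where Y: "Y \<in> carrier_mat d d" "X * Y = 1\<^sub>m d"
    using obtain_mat_inverse[OF X] det by (metis X_def)
  have "\<rho> s = \<rho> s * (X * Y)" using rep_carrier[OF rep s] by (simp add: Y(2))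
  also have "\<dots> = (\<rho> s * X) * Y" using rep_carrier[OF rep s] X Y(1) by simp
  also have "\<dots> = 1\<^sub>m d" by (simp only: X_def subgroup_sum_absorbs[OF rep S] Y(2)[unfolded X_def])
  finally show ?thesis .
qed

text \<open>Conjugation permutes \<open>N\<close>, so its sum is an intertwiner; being singular, it
  is zero by Schur's lemma.\<close>

lemma normal_sum_vanishes:
  assumes irr: "irr_rep G d \<rho>" and N: "N \<lhd> G" and s: "s \<in> N" "\<rho> s \<noteq> 1\<^sub>m d"
  shows "sum_mat d d \<rho> N = 0\<^sub>m d d"
proof -
  interpret N: normal N G by (rule N)
  note rep = irr_repD(2)[OF irr]
  have "intertwiner G d \<rho> d \<rho> (sum_mat d d \<rho> N)" unfolding intertwiner_def
  proof (intro conjI ballI)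
    fix g assume g: "g \<in> carrier G"
    have bij: "bij_betw (\<lambda>n. g \<otimes> n \<otimes> inv g) N N"
      by (rule bij_betw_byWitness[where f' = "\<lambda>n. inv g \<otimes> n \<otimes> g"])
        (use g N.inv_op_closed1 N.inv_op_closed2 in \<open>auto simp: m_assoc\<close>, simp_all flip: m_assoc)
    have "sum_mat d d \<rho> N * \<rho> g = sum_mat d d (\<lambda>n. \<rho> n * \<rho> g) N"
      using g by (intro sum_mat_mult) (auto intro: rep_carrier[OF rep])
    also have "\<dots> = sum_mat d d (\<lambda>n. \<rho> (g \<otimes> n \<otimes> inv g) * \<rho> g) N"
      by (rule sum_mat_reindex[OF bij, symmetric])
    also have "\<dots> = sum_mat d d (\<lambda>n. \<rho> g * \<rho> n) N"
      using g by (intro sum_mat_cong) (auto simp: m_assoc simp flip: rep_mult[OF rep])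
    also have "\<dots> = \<rho> g * sum_mat d d \<rho> N"
      using g by (intro mult_sum_mat[symmetric]) (auto intro: rep_carrier[OF rep])
    finally show "sum_mat d d \<rho> N * \<rho> g = \<rho> g * sum_mat d d \<rho> N" .
  qed simp
  then show ?thesis
    using Schur_lemma(2)[OF irr irr] subgroup_sum_nonsingular[OF rep N.subgroup_axioms s(1)] s(2) by blast
qed

text \<open>For normal \<open>N\<close> this says that \<open>G/N\<close> is abelian, phrased by
  commutators to avoid the quotient group.\<close>

definition abelian_mod :: "'a set \<Rightarrow> bool" where
  "abelian_mod N \<longleftrightarrow> (\<forall>g \<in> carrier G. \<forall>h \<in> carrier G. g \<otimes> h \<otimes> inv g \<otimes> inv h \<in> N)"

lemma irr_trivial_dim_one:
  assumes irr: "irr_rep G d \<rho>" and ab: "abelian_mod N" and triv: "\<And>s. s \<in> N \<Longrightarrow> \<rho> s = 1\<^sub>m d"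
  shows "d = 1"
proof (rule irr_commuting_dim_one[OF irr])
  note rep = irr_repD(2)[OF irr]
  fix g h assume gh: "g \<in> carrier G" "h \<in> carrier G"
  have "g \<otimes> h = (g \<otimes> h \<otimes> inv g \<otimes> inv h) \<otimes> (h \<otimes> g)"
  proof -
    have "inv h \<otimes> (h \<otimes> g) = g" using gh by (simp flip: m_assoc)
    then show ?thesis using gh by (simp add: m_assoc)
  qed
  then have "\<rho> (g \<otimes> h) = \<rho> (g \<otimes> h \<otimes> inv g \<otimes> inv h) * \<rho> (h \<otimes> g)"
    using gh rep_mult[OF rep, of "g \<otimes> h \<otimes> inv g \<otimes> inv h" "h \<otimes> g"] by simp
  also have "\<dots> = \<rho> (h \<otimes> g)"
    using gh ab triv rep_carrier[OF rep, of "h \<otimes> g"] by (simp add: abelian_mod_def)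
  finally show "\<rho> g * \<rho> h = \<rho> h * \<rho> g" using gh by (simp add: rep_mult[OF rep])
qed

lemma rep_kernel_normal:
  assumes rep: "is_rep G d \<rho>"
  shows "{g \<in> carrier G. \<rho> g = 1\<^sub>m d} \<lhd> G"
proof (rule normal_invI)
  show "subgroup {g \<in> carrier G. \<rho> g = 1\<^sub>m d} G"
  proof (rule subgroupI)
    fix a assume "a \<in> {g \<in> carrier G. \<rho> g = 1\<^sub>m d}"
    then show "inv a \<in> {g \<in> carrier G. \<rho> g = 1\<^sub>m d}"
      using rep_inv(1)[OF rep, of a] rep_carrier[OF rep, of "inv a"] by simp
  qed (use rep_one[OF rep] in \<open>auto simp: rep_mult[OF rep]\<close>)
  fix g h assume "g \<in> carrier G" "h \<in> {g \<in> carrier G. \<rho> g = 1\<^sub>m d}"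
  then show "g \<otimes> h \<otimes> inv g \<in> {g \<in> carrier G. \<rho> g = 1\<^sub>m d}"
    using rep_inv(1)[OF rep, of g] rep_carrier[OF rep, of g] by (simp add: rep_mult[OF rep])
qed

lemma smult_det_one_dim: "M \<in> carrier_mat d d \<Longrightarrow> d = 1 \<Longrightarrow> det M \<cdot>\<^sub>m 1\<^sub>m d = (M :: complex mat)"
  by (rule eq_matI) (auto simp: det_single)

text \<open>The hypotheses make \<open>N\<close> the normal closure of \<open>C\<close>. A
  representation trivial on \<open>N\<close> is one-dimensional, and there the sums over
  \<open>C\<close> and \<open>N\<close> are the scalars \<open>card C\<close> and
  \<open>card N\<close>. In every other one the sum over \<open>N\<close> vanishes and the sum over
  \<open>C\<close> is singular.\<close>

lemma red_norm_subgroup_sum: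
  assumes C: "subgroup C G" and N: "N \<lhd> G" and CN: "C \<subseteq> N" and ab: "abelian_mod N"
    and closure: "\<And>M. M \<lhd> G \<Longrightarrow> C \<subseteq> M \<Longrightarrow> N \<subseteq> M"
  shows "red_norm G 1 (\<lambda>_ _. ind C) = (\<lambda>g. of_nat (card C) / of_nat (card N) * ind N g)"
proof (rule red_norm_eqI)
  let ?q = "of_nat (card C) / of_nat (card N) :: complex"
  interpret N: normal N G by (rule N)
  have Cc: "C \<subseteq> carrier G" using C by (rule subgroup.subset)
  have cN: "card N > 0"
    using N.subset finite_carrier N.one_closed by (metis card_gt_0_iff empty_iff finite_subset)
  show "(\<lambda>g. ?q * ind N g) \<in> grp_ring G UNIV"
    using N.subset by (auto simp: grp_ring_def ind_def)
  fix d \<rho> assume irr: "irr_rep G d \<rho>"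
  note rep = irr_repD(2)[OF irr]
  have scale: "rep_ext G d \<rho> (\<lambda>g. ?q * ind N g) = ?q \<cdot>\<^sub>m sum_mat d d \<rho> N"
    unfolding rep_ext_ind[OF N.subset, symmetric]
    by (rule eq_matI) (auto simp: rep_ext_def sum_distrib_left mult.assoc)
  show "rep_ext G d \<rho> (\<lambda>g. ?q * ind N g) = det (rep_blk G d \<rho> 1 (\<lambda>_ _. ind C)) \<cdot>\<^sub>m 1\<^sub>m d"
  proof (cases "\<forall>s\<in>N. \<rho> s = 1\<^sub>m d")
    case True
    then have d: "d = 1" using irr_trivial_dim_one[OF irr ab] by blast
    have "sum_mat d d \<rho> S = of_nat (card S) \<cdot>\<^sub>m 1\<^sub>m d" if "S \<subseteq> N" for S
      using True that sum_mat_const[of "1\<^sub>m d" d d S] by (subst sum_mat_cong[of S S _ "\<lambda>_. 1\<^sub>m d"]) auto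
    then have S: "sum_mat d d \<rho> N = of_nat (card N) \<cdot>\<^sub>m 1\<^sub>m d" "sum_mat d d \<rho> C = of_nat (card C) \<cdot>\<^sub>m 1\<^sub>m d"
      using CN by auto
    show ?thesis unfolding scale rep_blk_one rep_ext_ind[OF Cc] S using cN
      by (intro eq_matI) (auto simp: d)
  next
    case False
    then obtain s where s: "s \<in> N" "\<rho> s \<noteq> 1\<^sub>m d" by blast
    \<comment> \<open>The kernel is normal, so if it contained \<open>C\<close> it would contain
      \<open>N\<close>.\<close>
    have "\<not> C \<subseteq> {g \<in> carrier G. \<rho> g = 1\<^sub>m d}" using closure[OF rep_kernel_normal[OF rep]] s by blast
    then obtain c where "c \<in> C" "\<rho> c \<noteq> 1\<^sub>m d" using Cc by blast
    then have "det (sum_mat d d \<rho> C) = 0" using subgroup_sum_nonsingular[OF rep C] by blast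
    then show ?thesis
      unfolding scale rep_blk_one rep_ext_ind[OF Cc] normal_sum_vanishes[OF irr N s]
      by (intro eq_matI) auto
  qed
qed

end

section \<open>Integral central elements on cosets\<close>

text \<open>Conjugation by \<open>A \<otimes> B\<close> and by \<open>B \<otimes> A\<close> both
  send \<open>X\<close> to its power with exponent \<open>i * j\<close>, so their quotient, the
  commutator, centralises \<open>X\<close>.\<close>

lemma (in group) power_automorphisms_commute:
  fixes i j :: int
  assumes A: "A \<in> carrier G" and B: "B \<in> carrier G" and X: "X \<in> carrier G"
    and i: "A \<otimes> X \<otimes> inv A = X [^] i" and j: "B \<otimes> X \<otimes> inv B = X [^] j"
  shows "inv A \<otimes> inv B \<otimes> A \<otimes> B \<otimes> X = X \<otimes> (inv A \<otimes> inv B \<otimes> A \<otimes> B)"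
proof -
  have conj_pow: "D \<otimes> X [^] k \<otimes> inv D = (D \<otimes> X \<otimes> inv D) [^] k"
    if D: "D \<in> carrier G" for D and k :: int
  proof -
    have inner: "inv D \<otimes> (D \<otimes> u) = u" if "u \<in> carrier G" for u
      using that D by (simp flip: m_assoc)
    have "(\<lambda>t. D \<otimes> t \<otimes> inv D) \<in> hom G G"
      using D by (auto simp: hom_def m_assoc inner)
    then interpret conj: group_hom G G "\<lambda>t. D \<otimes> t \<otimes> inv D" by unfold_locales
    show ?thesis using conj.hom_int_pow[OF X, of k] .
  qed
  have "A \<otimes> B \<otimes> X \<otimes> inv (A \<otimes> B) = A \<otimes> (B \<otimes> X \<otimes> inv B) \<otimes> inv A"
    using A B X by (simp add: m_assoc inv_mult_group)
  also have "\<dots> = X [^] (i * j)" using X by (simp add: j conj_pow[OF A] i int_pow_pow)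
  finally have 1: "A \<otimes> B \<otimes> X \<otimes> inv (A \<otimes> B) = X [^] (i * j)" .
  have "B \<otimes> A \<otimes> X \<otimes> inv (B \<otimes> A) = B \<otimes> (A \<otimes> X \<otimes> inv A) \<otimes> inv B"
    using A B X by (simp add: m_assoc inv_mult_group)
  also have "\<dots> = X [^] (i * j)" using X by (simp add: i conj_pow[OF B] j int_pow_pow mult.commute)
  finally have "A \<otimes> B \<otimes> X \<otimes> inv (A \<otimes> B) = B \<otimes> A \<otimes> X \<otimes> inv (B \<otimes> A)" using 1 by simp
  then have "inv (B \<otimes> A) \<otimes> (A \<otimes> B \<otimes> X \<otimes> inv (A \<otimes> B)) \<otimes> (A \<otimes> B)
      = inv (B \<otimes> A) \<otimes> (B \<otimes> A \<otimes> X \<otimes> inv (B \<otimes> A)) \<otimes> (A \<otimes> B)" by simp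
  moreover have "inv (B \<otimes> A) \<otimes> (A \<otimes> B \<otimes> X \<otimes> inv (A \<otimes> B)) \<otimes> (A \<otimes> B) = inv (B \<otimes> A) \<otimes> (A \<otimes> B) \<otimes> X"
    using A B X by (simp add: m_assoc del: inv_mult_group)
  moreover have "inv (B \<otimes> A) \<otimes> (B \<otimes> A \<otimes> X \<otimes> inv (B \<otimes> A)) \<otimes> (A \<otimes> B) = X \<otimes> (inv (B \<otimes> A) \<otimes> (A \<otimes> B))"
  proof -
    define D where "D = B \<otimes> A"
    have D: "D \<in> carrier G" using A B by (simp add: D_def)
    have inner: "inv D \<otimes> (D \<otimes> u) = u" if "u \<in> carrier G" for u
      using that D by (simp flip: m_assoc)
    show ?thesis unfolding D_def[symmetric] using A B X D by (simp add: m_assoc inner)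
  qed
  ultimately show ?thesis using A B X by (simp add: inv_mult_group m_assoc)
qed

lemma (in normal) quotient_hom_fibres:
  "group_hom G (G Mod H) (\<lambda>g. H #> g)"
  "a \<in> carrier G \<Longrightarrow> b \<in> carrier G \<Longrightarrow> H #> a = H #> b \<longleftrightarrow> (\<exists>k\<in>H. a = b \<otimes> k)"
proof -
  show "group_hom G (G Mod H) (\<lambda>g. H #> g)"
    by (intro group_hom.intro group_hom_axioms.intro is_group factorgroup_is_group r_coset_hom_Mod)
  assume a: "a \<in> carrier G" and b: "b \<in> carrier G"
  show "H #> a = H #> b \<longleftrightarrow> (\<exists>k\<in>H. a = b \<otimes> k)"
  proof
    assume "H #> a = H #> b"
    then have "a \<in> H #> b" using rcos_self[OF a subgroup_axioms] by simp
    then show "\<exists>k\<in>H. a = b \<otimes> k" using coset_eq b by (auto simp: l_coset_def)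
  next
    assume "\<exists>k\<in>H. a = b \<otimes> k"
    then have "a \<in> H #> b" using coset_eq b by (auto simp: l_coset_def)
    then show "H #> a = H #> b" using repr_independence[OF _ b subgroup_axioms] by simp
  qed
qed

text \<open>Elements of \<open>K\<close> contribute exponent 0 and \<open>x\<close> contributes
  exponent 1, so the image is cyclic, generated by \<open>h x\<close>.\<close>

lemma (in group_hom) hom_generate_insert_kernel:
  assumes x: "x \<in> carrier G" and K: "K \<subseteq> carrier G" "\<And>k. k \<in> K \<Longrightarrow> h k = \<one>\<^bsub>H\<^esub>"
    and w: "w \<in> generate G (insert x K)"
  shows "\<exists>i::int. h w = h x [^]\<^bsub>H\<^esub> i"
  using w
proof (induction rule: generate.induct)
  case one
  have "h \<one> = h x [^]\<^bsub>H\<^esub> (0::int)" by simp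
  then show ?case by blast
next
  case (incl w)
  have "h w = h x [^]\<^bsub>H\<^esub> (if w = x then 1 else 0 :: int)"
    using incl K x by (auto simp: H.int_pow_1)
  then show ?case by blast
next
  case (inv w)
  have "h (inv w) = h x [^]\<^bsub>H\<^esub> (if w = x then - 1 else 0 :: int)"
  proof (cases "w = x")
    case True
    then show ?thesis using x H.int_pow_neg[of "h x" 1] by (simp add: H.int_pow_1)
  next
    case False
    then have "w \<in> K" using inv by simp
    then have "h (inv w) = inv\<^bsub>H\<^esub> h w" using K(1) by (intro hom_inv) auto
    then show ?thesis using False \<open>w \<in> K\<close> K(2) by simp
  qed
  then show ?case by blast
next
  case (eng u w)
  then obtain i j :: int where "h u = h x [^]\<^bsub>H\<^esub> i" "h w = h x [^]\<^bsub>H\<^esub> j" by blast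
  moreover have "u \<in> carrier G" "w \<in> carrier G"
    using eng G.generate_incl[of "insert x K"] x K(1) by auto
  ultimately have "h (u \<otimes> w) = h x [^]\<^bsub>H\<^esub> (i + j)" using x by (simp add: H.int_pow_mult)
  then show ?case by blast
qed

context finite_group begin

section \<open>Coset sums of central elements and of reduced norms\<close>

text \<open>Compare the coefficients at \<open>y \<otimes> g\<close> of \<open>z\<close> times
  \<open>y\<close> and \<open>y\<close> times \<open>z\<close>.\<close>

lemma central_conj_invariant:
  assumes z: "z \<in> grp_centre G \<int>" and y: "y \<in> carrier G" and g: "g \<in> carrier G"
  shows "z (y \<otimes> g \<otimes> inv y) = z g"
proof -
  have "ind {y} \<in> grp_ring G \<int>" using y by (intro ind_grp_ring) auto
  then have "grp_mult G z (ind {y}) = grp_mult G (ind {y}) z" using z by (simp add: grp_centre_def)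
  then have "grp_mult G z (ind {y}) (y \<otimes> g) = grp_mult G (ind {y}) z (y \<otimes> g)" by simp
  then show ?thesis using y g
    by (simp add: grp_mult_ind_single_left grp_mult_ind_single_right) (simp flip: m_assoc)
qed

text \<open>By \<open>conj\<close>, the cosets of \<open>K\<close> inside \<open>x M\<close> are
  conjugate to each other, so \<open>z\<close> has the same integral sum over each of them. There
  are more than one, and hence these sums cannot add up to 1.\<close>

lemma no_unit_coset_sum:
  assumes z: "z \<in> grp_centre G \<int>" and K: "K \<lhd> G" and M: "subgroup M G" and KM: "K \<subset> M"
    and x: "x \<in> carrier G"
    and conj: "\<And>m. m \<in> M \<Longrightarrow> \<exists>y \<in> carrier G. \<exists>k \<in> K. y \<otimes> x \<otimes> inv y = x \<otimes> m \<otimes> k"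
  shows "(\<Sum>m\<in>M. z (x \<otimes> m)) \<noteq> 1"
proof
  assume sum: "(\<Sum>m\<in>M. z (x \<otimes> m)) = 1"
  interpret K: normal K G by (rule K)
  interpret M: subgroup M G by (rule M)
  \<comment> \<open>\<open>F g\<close> is the sum of \<open>z\<close> over the coset
    \<open>g K\<close>; it depends only on the coset and is invariant under conjugation.\<close>
  define F where "F g = (\<Sum>k\<in>K. z (g \<otimes> k))" for g
  have F_mult: "F (g \<otimes> k) = F g" if g: "g \<in> carrier G" and k: "k \<in> K" for g k
  proof -
    have "bij_betw (\<lambda>l. k \<otimes> l) K K"
      by (rule bij_betw_byWitness[where f' = "\<lambda>l. inv k \<otimes> l"]) (use k in \<open>auto simp flip: m_assoc\<close>)
    then have "(\<Sum>l\<in>K. z (g \<otimes> (k \<otimes> l))) = F g"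
      unfolding F_def by (rule sum.reindex_bij_betw[where g = "\<lambda>l. z (g \<otimes> l)"])
    moreover have "F (g \<otimes> k) = (\<Sum>l\<in>K. z (g \<otimes> (k \<otimes> l)))"
      unfolding F_def using g k by (intro sum.cong) (auto simp: m_assoc)
    ultimately show ?thesis by simp
  qed
  have F_conj: "F (y \<otimes> g \<otimes> inv y) = F g" if y: "y \<in> carrier G" and g: "g \<in> carrier G" for y g
  proof -
    have inner: "y \<otimes> (inv y \<otimes> u) = u" "inv y \<otimes> (y \<otimes> u) = u" if "u \<in> carrier G" for u
      using that y by (simp_all flip: m_assoc)
    have bij: "bij_betw (\<lambda>k. y \<otimes> k \<otimes> inv y) K K"
      by (rule bij_betw_byWitness[where f' = "\<lambda>k. inv y \<otimes> k \<otimes> y"])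
        (use y K.inv_op_closed1 K.inv_op_closed2 in \<open>auto simp: m_assoc inner\<close>)
    have "F (y \<otimes> g \<otimes> inv y) = (\<Sum>k\<in>K. z (y \<otimes> g \<otimes> inv y \<otimes> (y \<otimes> k \<otimes> inv y)))"
      unfolding F_def
      by (rule sum.reindex_bij_betw[OF bij, where g = "\<lambda>k. z (y \<otimes> g \<otimes> inv y \<otimes> k)", symmetric])
    also have "\<dots> = F g" unfolding F_def
    proof (rule sum.cong[OF refl])
      fix k assume k: "k \<in> K"
      have "y \<otimes> g \<otimes> inv y \<otimes> (y \<otimes> k \<otimes> inv y) = y \<otimes> (g \<otimes> k) \<otimes> inv y"
        using y g k by (simp add: m_assoc inner)
      then show "z (y \<otimes> g \<otimes> inv y \<otimes> (y \<otimes> k \<otimes> inv y)) = z (g \<otimes> k)"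
        using central_conj_invariant[OF z y, of "g \<otimes> k"] g k by simp
    qed
    finally show ?thesis .
  qed
  have F_const: "F (x \<otimes> m) = F x" if m: "m \<in> M" for m
  proof -
    obtain y k where yk: "y \<in> carrier G" "k \<in> K" "y \<otimes> x \<otimes> inv y = x \<otimes> m \<otimes> k" using conj[OF m] by blast
    have "F (x \<otimes> m) = F (x \<otimes> m \<otimes> k)" using F_mult[of "x \<otimes> m" k] x m yk(2) by simp
    also have "\<dots> = F x" using F_conj[OF yk(1) x] yk(3) by simp
    finally show ?thesis .
  qed
  \<comment> \<open>Letting \<open>m\<close> run through \<open>M\<close> counts every coset of
    \<open>K\<close> in \<open>x M\<close> \<open>card K\<close> times, so division of group orders
    is avoided.\<close>
  have "of_nat (card M) * F x = (\<Sum>m\<in>M. F (x \<otimes> m))" by (simp add: F_const)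
  also have "\<dots> = (\<Sum>k\<in>K. \<Sum>m\<in>M. z (x \<otimes> m \<otimes> k))" unfolding F_def by (rule sum.swap)
  also have "\<dots> = (\<Sum>k\<in>K. 1)"
  proof (rule sum.cong[OF refl])
    fix k assume k: "k \<in> K"
    then have kM: "k \<in> M" using KM by blast
    have bij: "bij_betw (\<lambda>m. m \<otimes> k) M M"
      by (rule bij_betw_byWitness[where f' = "\<lambda>m. m \<otimes> inv k"]) (use kM in \<open>auto simp: m_assoc\<close>)
    have "(\<Sum>m\<in>M. z (x \<otimes> m \<otimes> k)) = (\<Sum>m\<in>M. z (x \<otimes> (m \<otimes> k)))"
      using x kM by (intro sum.cong) (auto simp: m_assoc)
    also have "\<dots> = (\<Sum>m\<in>M. z (x \<otimes> m))" by (rule sum.reindex_bij_betw[OF bij])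
    finally show "(\<Sum>m\<in>M. z (x \<otimes> m \<otimes> k)) = 1" by (simp add: sum)
  qed
  finally have eq: "of_nat (card M) * F x = of_nat (card K)" by simp
  \<comment> \<open>An integer \<open>F x\<close> with \<open>card M * F x = card K\<close> is
    positive, which contradicts \<open>card K < card M\<close>.\<close>
  have "F x \<in> \<int>" unfolding F_def
    using z x by (intro Ints_sum) (auto simp: grp_centre_def grp_ring_def)
  then obtain n where n: "F x = of_int n" by (auto elim: Ints_cases)
  have "complex_of_int (int (card M) * n) = complex_of_int (int (card K))" using eq n by simp
  then have dvd: "int (card M) * n = int (card K)" by (simp only: of_int_eq_iff)
  have finM: "finite M" using M.subset finite_carrier finite_subset by blast
  have lt: "card K < card M" using psubset_card_mono[OF finM KM] .
  have pos: "card K > 0"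
    using K.one_closed KM finM by (metis card_gt_0_iff empty_iff finite_subset psubset_imp_subset)
  have "n > 0" using zero_less_mult_pos[of "int (card M)" n] dvd pos lt by simp
  then have "int (card M) * 1 \<le> int (card M) * n" by (intro mult_left_mono) auto
  then show False using dvd lt by simp
qed

text \<open>The reduced norm of \<open>x\<close> and \<open>x\<close> itself agree after
  multiplication by the sum over \<open>M\<close>: representations trivial on \<open>M\<close> are
  one-dimensional, so the determinant changes nothing, and in all others that sum vanishes.\<close>

lemma red_norm_element_coset_sum:
  assumes M: "M \<lhd> G" and ab: "abelian_mod M" and x: "x \<in> carrier G"
  shows "(\<Sum>m\<in>M. red_norm G 1 (\<lambda>_ _. ind {x}) (x \<otimes> m)) = 1"
proof -
  interpret M: normal M G by (rule M)
  let ?z = "red_norm G 1 (\<lambda>_ _. ind {x})"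
  have "grp_mult G ?z (ind M) = grp_mult G (ind {x}) (ind M)"
  proof (rule irr_reps_separate[OF grp_mult_grp_ring_UNIV grp_mult_grp_ring_UNIV])
    fix d \<rho> assume irr: "irr_rep G d \<rho>"
    note rep = irr_repD(2)[OF irr]
    show "rep_ext G d \<rho> (grp_mult G ?z (ind M)) = rep_ext G d \<rho> (grp_mult G (ind {x}) (ind M))"
    proof (cases "\<forall>s\<in>M. \<rho> s = 1\<^sub>m d")
      case True
      then have d: "d = 1" using irr_trivial_dim_one[OF irr ab] by blast
      have "rep_ext G d \<rho> ?z = rep_ext G d \<rho> (ind {x})"
        unfolding rep_ext_red_norm_single[OF irr] by (rule smult_det_one_dim[OF rep_ext_carrier d])
      then show ?thesis by (simp only: rep_ext_mult[OF rep])
    next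
      case False
      then have "sum_mat d d \<rho> M = 0\<^sub>m d d" using normal_sum_vanishes[OF irr M] by blast
      then show ?thesis
        unfolding rep_ext_mult[OF rep] rep_ext_ind[OF M.subset]
        by (simp only: right_mult_zero_mat[OF rep_ext_carrier])
    qed
  qed
  \<comment> \<open>The coefficient at \<open>x\<close> is 1 on the right; on the left it is the sum
    of \<open>?z\<close> over the coset \<open>x M\<close>.\<close>
  then have "grp_mult G ?z (ind M) x = ind M \<one>" using grp_mult_ind_single_left[OF x x] x by simp
  then have "1 = (\<Sum>y\<in>carrier G. ?z y * ind M (inv y \<otimes> x))"
    using x by (simp add: grp_mult_def) (simp add: ind_def)
  also have "\<dots> = (\<Sum>y\<in>{y \<in> carrier G. inv y \<otimes> x \<in> M}. ?z y)"
    using finite_carrier by (intro sum.mono_neutral_cong_right) (auto simp: ind_def)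
  also have "\<dots> = (\<Sum>m\<in>M. ?z (x \<otimes> m))"
  proof (rule sum.reindex_bij_betw[symmetric])
    have inner: "x \<otimes> (inv x \<otimes> u) = u" "inv x \<otimes> (x \<otimes> u) = u" if "u \<in> carrier G" for u
      using that x by (simp_all flip: m_assoc)
    have "inv x \<otimes> y \<in> M" if "y \<in> carrier G" "inv y \<otimes> x \<in> M" for y
      using M.m_inv_closed[OF that(2)] that(1) x by (simp add: inv_mult_group)
    then show "bij_betw (\<lambda>m. x \<otimes> m) M {y \<in> carrier G. inv y \<otimes> x \<in> M}"
      by (intro bij_betw_byWitness[where f' = "\<lambda>y. inv x \<otimes> y"])
        (use x in \<open>auto simp: inner inv_mult_group m_assoc\<close>)
  qed
  finally show ?thesis by simp
qed

text \<open>Let \<open>N\<close> be the normal closure of \<open>C\<close>. The reduced norm of the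
  sum over \<open>C\<close> has coefficient \<open>card C / card N\<close> on \<open>N\<close>, and
  integrality together with \<open>C \<subseteq> N\<close> forces \<open>C = N\<close>.\<close>

lemma subgroup_normal_if_red_norm_integral:
  assumes nr: "\<And>h. h \<in> grp_ring G \<int> \<Longrightarrow> red_norm G 1 (\<lambda>_ _. h) \<in> grp_centre G \<int>"
    and K: "\<And>N. N \<lhd> G \<Longrightarrow> K \<subset> N \<Longrightarrow> abelian_mod N" and C: "subgroup C G" and KC: "K \<subset> C"
  shows "C \<lhd> G"
proof -
  interpret C: subgroup C G by (rule C)
  define S where "S = {g \<otimes> c \<otimes> inv g | g c. g \<in> carrier G \<and> c \<in> C}"
  define N where "N = generate G S"
  have S: "S \<subseteq> carrier G" by (auto simp: S_def)
  have "C \<subseteq> S"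
  proof
    fix c assume "c \<in> C"
    then have "c = \<one> \<otimes> c \<otimes> inv \<one>" by simp
    then show "c \<in> S" unfolding S_def using \<open>c \<in> C\<close> by blast
  qed
  have N: "N \<lhd> G" unfolding N_def
  proof (rule normal_generateI[OF S])
    fix h g assume "h \<in> S" and g: "g \<in> carrier G"
    then obtain a c where ac: "h = a \<otimes> c \<otimes> inv a" "a \<in> carrier G" "c \<in> C" by (auto simp: S_def)
    have "g \<otimes> h \<otimes> inv g = (g \<otimes> a) \<otimes> c \<otimes> inv (g \<otimes> a)" using ac g by (simp add: m_assoc inv_mult_group)
    then show "g \<otimes> h \<otimes> inv g \<in> S" unfolding S_def using ac g by blast
  qed
  interpret N: normal N G by (rule N)
  have CN: "C \<subseteq> N" using \<open>C \<subseteq> S\<close> by (auto simp: N_def intro: generate.incl)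
  have ab: "abelian_mod N" using K[OF N] KC CN by blast
  have closure: "N \<subseteq> M" if M: "M \<lhd> G" "C \<subseteq> M" for M
    unfolding N_def
  proof (rule generate_subgroup_incl)
    interpret M: normal M G by (rule M(1))
    show "S \<subseteq> M" using M(2) M.inv_op_closed2 by (auto simp: S_def)
    show "subgroup M G" by (rule M.subgroup_axioms)
  qed
  have "(\<lambda>g. of_nat (card C) / of_nat (card N) * ind N g) \<in> grp_centre G \<int>"
    using nr[OF ind_grp_ring[OF C.subset]] red_norm_subgroup_sum[OF C N CN ab closure] by simp
  \<comment> \<open>Read off the coefficient at the identity.\<close>
  then have "of_nat (card C) / of_nat (card N) * ind N \<one> \<in> \<int>"
    unfolding grp_centre_def grp_ring_def by blast
  then have "of_nat (card C) / of_nat (card N) \<in> (\<int> :: complex set)" by (simp add: ind_def)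
  then obtain n where n: "of_nat (card C) / of_nat (card N) = complex_of_int n" by (auto elim: Ints_cases)
  have fin: "finite N" using N.subset finite_carrier finite_subset by blast
  have pos: "card N > 0" "card C > 0"
    using N.one_closed C.one_closed CN fin by (metis card_gt_0_iff empty_iff finite_subset)+
  have "complex_of_int (int (card C)) = complex_of_int (n * int (card N))"
    using n pos by (simp add: field_simps)
  then have eq: "int (card C) = n * int (card N)" by (simp only: of_int_eq_iff)
  then have "n > 0" using pos by (metis of_nat_0_less_iff zero_less_mult_pos2)
  then have "1 * int (card N) \<le> n * int (card N)" by (intro mult_right_mono) auto
  then have "card N \<le> card C" using eq by simp
  then have "C = N" using card_seteq[OF fin CN] by simp
  then show ?thesis using N by simp
qed

end

section \<open>Groups with integral reduced norms\<close>

lemma (in group) commute_inv: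
  assumes "Z \<in> carrier G" "T \<in> carrier G" "Z \<otimes> T = T \<otimes> Z"
  shows "inv Z \<otimes> T = T \<otimes> inv Z"
proof -
  have "inv Z \<otimes> (Z \<otimes> T) \<otimes> inv Z = inv Z \<otimes> (T \<otimes> Z) \<otimes> inv Z" by (simp add: assms(3))
  moreover have "inv Z \<otimes> (Z \<otimes> T) \<otimes> inv Z = T \<otimes> inv Z" using assms(1,2) by (simp flip: m_assoc)
  moreover have "inv Z \<otimes> (T \<otimes> Z) \<otimes> inv Z = inv Z \<otimes> T" using assms(1,2) by (simp add: m_assoc)
  ultimately show ?thesis by simp
qed

lemma (in group) conj_by_inv_central:
  assumes c: "A \<in> carrier G" "X \<in> carrier G" "Z \<in> carrier G"
    and comm: "Z \<otimes> A = A \<otimes> Z" and conj: "A \<otimes> X \<otimes> inv A = X \<otimes> Z"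
  shows "inv A \<otimes> X \<otimes> A = X \<otimes> inv Z"
proof -
  have "inv A \<otimes> X \<otimes> A \<otimes> Z = inv A \<otimes> (X \<otimes> Z) \<otimes> A" using c by (simp add: m_assoc comm[symmetric])
  also have "\<dots> = inv A \<otimes> (A \<otimes> X \<otimes> inv A) \<otimes> A" by (simp add: conj)
  also have "\<dots> = inv A \<otimes> A \<otimes> X \<otimes> (inv A \<otimes> A)" using c by (simp only: m_assoc m_closed inv_closed)
  also have "\<dots> = X" using c by simp
  finally have "inv A \<otimes> X \<otimes> A \<otimes> Z \<otimes> inv Z = X \<otimes> inv Z" by simp
  then show ?thesis using c by (simp add: m_assoc)
qed

text \<open>The hypothesis \<open>pow\<close> says that conjugation acts on each cyclic subgroup of
  the image by powers, so the images of commutators centralise every \<open>h t\<close>.\<close>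

lemma (in group_hom) hom_commutator_central:
  assumes pow: "\<And>t w. t \<in> carrier G \<Longrightarrow> w \<in> carrier G \<Longrightarrow> \<exists>i::int. h (w \<otimes> t \<otimes> inv w) = h t [^]\<^bsub>H\<^esub> i"
    and x: "x \<in> carrier G" and y: "y \<in> carrier G" and t: "t \<in> carrier G"
  shows "h (inv x \<otimes> y \<otimes> x \<otimes> inv y) \<otimes>\<^bsub>H\<^esub> h t = h t \<otimes>\<^bsub>H\<^esub> h (inv x \<otimes> y \<otimes> x \<otimes> inv y)"
proof -
  \<comment> \<open>Taking \<open>A = h x\<close> and \<open>B\<close> the inverse of
    \<open>h y\<close> gives the commutator in the desired order.\<close>
  obtain i j :: int where "h (x \<otimes> t \<otimes> inv x) = h t [^]\<^bsub>H\<^esub> i"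
    "h (inv y \<otimes> t \<otimes> inv (inv y)) = h t [^]\<^bsub>H\<^esub> j"
    using pow[OF t x] pow[OF t G.inv_closed[OF y]] by blast
  then have "h x \<otimes>\<^bsub>H\<^esub> h t \<otimes>\<^bsub>H\<^esub> inv\<^bsub>H\<^esub> h x = h t [^]\<^bsub>H\<^esub> i"
    "inv\<^bsub>H\<^esub> h y \<otimes>\<^bsub>H\<^esub> h t \<otimes>\<^bsub>H\<^esub> inv\<^bsub>H\<^esub> (inv\<^bsub>H\<^esub> h y) = h t [^]\<^bsub>H\<^esub> j"
    using x y t by simp_all
  from H.power_automorphisms_commute[OF _ _ _ this] x y t show ?thesis by simp
qed

text \<open>The good \<open>m\<close> form a subgroup containing \<open>c\<close> and
  \<open>K\<close>: if \<open>v\<close> and \<open>w\<close> conjugate \<open>x\<close> to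
  \<open>x \<otimes> m\<close> and \<open>x \<otimes> n\<close> modulo the kernel, then
  \<open>v \<otimes> w\<close> conjugates it to \<open>x \<otimes> m \<otimes> n\<close>, because
  the image of \<open>n\<close> is central.\<close>

lemma (in group_hom) conjugates_fill_coset:
  assumes x: "x \<in> carrier G" and y: "y \<in> carrier G" and c: "c = inv x \<otimes> y \<otimes> x \<otimes> inv y"
    and K: "K \<subseteq> carrier G" "\<And>k. k \<in> K \<Longrightarrow> h k = \<one>\<^bsub>H\<^esub>"
    and central: "\<And>t. t \<in> carrier G \<Longrightarrow> h c \<otimes>\<^bsub>H\<^esub> h t = h t \<otimes>\<^bsub>H\<^esub> h c"
    and m: "m \<in> generate G (insert c K)"
  shows "\<exists>w \<in> carrier G. h (w \<otimes> x \<otimes> inv w) = h (x \<otimes> m)"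
proof -
  \<comment> \<open>Centrality is part of the definition, since closure under products and inverses
    relies on it.\<close>
  define S where "S = {m \<in> carrier G. (\<forall>t \<in> carrier G. h m \<otimes>\<^bsub>H\<^esub> h t = h t \<otimes>\<^bsub>H\<^esub> h m) \<and>
    (\<exists>w \<in> carrier G. h w \<otimes>\<^bsub>H\<^esub> h x \<otimes>\<^bsub>H\<^esub> inv\<^bsub>H\<^esub> h w = h x \<otimes>\<^bsub>H\<^esub> h m)}"
  have cG: "c \<in> carrier G" using x y by (simp add: c)
  have trivial: "k \<in> S" if "k \<in> carrier G" "h k = \<one>\<^bsub>H\<^esub>" for k
    using that x unfolding S_def by (auto intro!: bexI[of _ \<one>])
  \<comment> \<open>This is the reason for the form of \<open>c\<close>.\<close>
  have "y \<otimes> x \<otimes> inv y = x \<otimes> c"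
    using x y unfolding c by (simp add: G.m_assoc[symmetric])
  then have "h (y \<otimes> x \<otimes> inv y) = h (x \<otimes> c)" by simp
  then have "h y \<otimes>\<^bsub>H\<^esub> h x \<otimes>\<^bsub>H\<^esub> inv\<^bsub>H\<^esub> h y = h x \<otimes>\<^bsub>H\<^esub> h c" using x y cG by simp
  then have "c \<in> S" using central cG y unfolding S_def by blast
  moreover have "K \<subseteq> S" using K trivial by blast
  moreover have "subgroup S G"
  proof (rule G.subgroupI)
    show "S \<subseteq> carrier G" by (auto simp: S_def)
    show "S \<noteq> {}" using trivial[of \<one>] by auto
  next
    fix m assume "m \<in> S"
    then obtain w where m: "m \<in> carrier G" "\<And>t. t \<in> carrier G \<Longrightarrow> h m \<otimes>\<^bsub>H\<^esub> h t = h t \<otimes>\<^bsub>H\<^esub> h m"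
      and w: "w \<in> carrier G" "h w \<otimes>\<^bsub>H\<^esub> h x \<otimes>\<^bsub>H\<^esub> inv\<^bsub>H\<^esub> h w = h x \<otimes>\<^bsub>H\<^esub> h m"
      by (auto simp: S_def)
    have "h (inv m) \<otimes>\<^bsub>H\<^esub> h t = h t \<otimes>\<^bsub>H\<^esub> h (inv m)" if "t \<in> carrier G" for t
      using H.commute_inv[OF _ _ m(2)[OF that]] m(1) that by simp
    moreover have "h (inv w) \<otimes>\<^bsub>H\<^esub> h x \<otimes>\<^bsub>H\<^esub> inv\<^bsub>H\<^esub> h (inv w) = h x \<otimes>\<^bsub>H\<^esub> h (inv m)"
      using H.conj_by_inv_central[OF _ _ _ m(2)[OF w(1)] w(2)] m(1) w(1) x by simp
    ultimately show "inv m \<in> S" using m(1) w(1) unfolding S_def by blast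
  next
    fix m n assume "m \<in> S" "n \<in> S"
    then obtain v w where m: "m \<in> carrier G" "\<And>t. t \<in> carrier G \<Longrightarrow> h m \<otimes>\<^bsub>H\<^esub> h t = h t \<otimes>\<^bsub>H\<^esub> h m"
      and n: "n \<in> carrier G" "\<And>t. t \<in> carrier G \<Longrightarrow> h n \<otimes>\<^bsub>H\<^esub> h t = h t \<otimes>\<^bsub>H\<^esub> h n"
      and v: "v \<in> carrier G" "h v \<otimes>\<^bsub>H\<^esub> h x \<otimes>\<^bsub>H\<^esub> inv\<^bsub>H\<^esub> h v = h x \<otimes>\<^bsub>H\<^esub> h m"
      and w: "w \<in> carrier G" "h w \<otimes>\<^bsub>H\<^esub> h x \<otimes>\<^bsub>H\<^esub> inv\<^bsub>H\<^esub> h w = h x \<otimes>\<^bsub>H\<^esub> h n"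
      by (auto simp: S_def)
    have "h (m \<otimes> n) \<otimes>\<^bsub>H\<^esub> h t = h t \<otimes>\<^bsub>H\<^esub> h (m \<otimes> n)" if t: "t \<in> carrier G" for t
    proof -
      have "h (m \<otimes> n) \<otimes>\<^bsub>H\<^esub> h t = h m \<otimes>\<^bsub>H\<^esub> (h n \<otimes>\<^bsub>H\<^esub> h t)" using m(1) n(1) t by (simp add: H.m_assoc)
      also have "\<dots> = (h m \<otimes>\<^bsub>H\<^esub> h t) \<otimes>\<^bsub>H\<^esub> h n" using m(1) n(1) t by (simp add: n(2) H.m_assoc)
      also have "\<dots> = h t \<otimes>\<^bsub>H\<^esub> h (m \<otimes> n)" using m(1) n(1) t by (simp add: m(2) H.m_assoc)
      finally show ?thesis .
    qed
    moreover have "h (v \<otimes> w) \<otimes>\<^bsub>H\<^esub> h x \<otimes>\<^bsub>H\<^esub> inv\<^bsub>H\<^esub> h (v \<otimes> w) = h x \<otimes>\<^bsub>H\<^esub> h (m \<otimes> n)"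
    proof -
      have "h (v \<otimes> w) \<otimes>\<^bsub>H\<^esub> h x \<otimes>\<^bsub>H\<^esub> inv\<^bsub>H\<^esub> h (v \<otimes> w)
          = h v \<otimes>\<^bsub>H\<^esub> (h w \<otimes>\<^bsub>H\<^esub> h x \<otimes>\<^bsub>H\<^esub> inv\<^bsub>H\<^esub> h w) \<otimes>\<^bsub>H\<^esub> inv\<^bsub>H\<^esub> h v"
        using v(1) w(1) x by (simp add: H.m_assoc H.inv_mult_group)
      also have "\<dots> = h v \<otimes>\<^bsub>H\<^esub> h x \<otimes>\<^bsub>H\<^esub> (h n \<otimes>\<^bsub>H\<^esub> h (inv v))"
        using v(1) x n(1) by (simp add: w(2) H.m_assoc)
      also have "\<dots> = (h v \<otimes>\<^bsub>H\<^esub> h x \<otimes>\<^bsub>H\<^esub> inv\<^bsub>H\<^esub> h v) \<otimes>\<^bsub>H\<^esub> h n"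
        using v(1) x n(1) by (simp only: n(2) G.inv_closed) (simp add: H.m_assoc)
      also have "\<dots> = h x \<otimes>\<^bsub>H\<^esub> h (m \<otimes> n)" using x m(1) n(1) by (simp add: v(2) H.m_assoc)
      finally show ?thesis .
    qed
    ultimately show "m \<otimes> n \<in> S" using m(1) n(1) v(1) w(1) unfolding S_def by blast
  qed
  ultimately have "m \<in> S" using m G.generate_subgroup_incl[of "insert c K" S] by blast
  then obtain w where "m \<in> carrier G" "w \<in> carrier G"
    "h w \<otimes>\<^bsub>H\<^esub> h x \<otimes>\<^bsub>H\<^esub> inv\<^bsub>H\<^esub> h w = h x \<otimes>\<^bsub>H\<^esub> h m" by (auto simp: S_def)
  then show ?thesis using x by (intro bexI[of _ w]) auto
qed

context finite_group begin

lemma comm_group_if_red_norm_integral: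
  assumes nr: "\<And>h. h \<in> grp_ring G \<int> \<Longrightarrow> red_norm G 1 (\<lambda>_ _. h) \<in> grp_centre G \<int>"
  shows "comm_group G"
proof (rule ccontr)
  assume nc: "\<not> comm_group G"
  \<comment> \<open>The family is finite and, as \<open>G\<close> is not abelian, contains the
    trivial subgroup; so it has a maximal member \<open>K\<close>.\<close>
  define \<N> where "\<N> = {N. N \<lhd> G \<and> \<not> abelian_mod N}"
  have "\<N> \<subseteq> Pow (carrier G)" by (auto simp: \<N>_def normal_def dest: subgroup.subset[THEN subsetD])
  then have "finite \<N>" using finite_carrier by (meson finite_Pow_iff finite_subset)
  moreover have "{\<one>} \<in> \<N>"
  proof -
    have "\<not> abelian_mod {\<one>}"
    proof
      assume ab: "abelian_mod {\<one>}"
      have "comm_group G"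
      proof (rule group_comm_groupI)
        fix g h assume gh: "g \<in> carrier G" "h \<in> carrier G"
        have "g \<otimes> h \<otimes> inv g \<otimes> inv h = \<one>" using ab gh by (simp add: abelian_mod_def)
        then have "g \<otimes> h \<otimes> inv (h \<otimes> g) = \<one>" using gh by (simp add: inv_mult_group m_assoc)
        then show "g \<otimes> h = h \<otimes> g" using gh by (metis inv_equality inv_inv m_closed inv_closed)
      qed
      then show False using nc by simp
    qed
    then show ?thesis by (simp add: \<N>_def one_is_normal)
  qed
  ultimately obtain K where "K \<in> \<N>" and max: "\<And>N. N \<in> \<N> \<Longrightarrow> K \<subseteq> N \<Longrightarrow> K = N"
    using finite_has_maximal[of \<N>] by blast
  then have K: "K \<lhd> G" and nab: "\<not> abelian_mod K" by (auto simp: \<N>_def)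
  interpret K: normal K G by (rule K)
  have above: "abelian_mod N" if "N \<lhd> G" "K \<subset> N" for N using max[of N] that by (auto simp: \<N>_def)
  \<comment> \<open>Subgroups strictly above \<open>K\<close> are covered by
    \<open>subgroup_normal_if_red_norm_integral\<close>, and \<open>K\<close> itself is
    normal.\<close>
  have dedekind: "C \<lhd> G" if "subgroup C G" "K \<subseteq> C" for C
    using subgroup_normal_if_red_norm_integral[OF nr above that(1)] that(2) K by blast
  obtain g h where gh: "g \<in> carrier G" "h \<in> carrier G" "g \<otimes> h \<otimes> inv g \<otimes> inv h \<notin> K"
    using nab by (auto simp: abelian_mod_def)
  \<comment> \<open>With the inverse of \<open>g\<close>, the commutator \<open>c\<close> equals
    \<open>g \<otimes> h \<otimes> inv g \<otimes> inv h\<close>, which lies outside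
    \<open>K\<close>.\<close>
  define x where "x = inv g"
  define c where "c = inv x \<otimes> h \<otimes> x \<otimes> inv h"
  have x: "x \<in> carrier G" and c: "c \<in> carrier G" "c \<notin> K" using gh by (auto simp: x_def c_def)
  define \<phi> where "\<phi> a = K #> a" for a
  define Q where "Q = G Mod K"
  interpret \<phi>: group_hom G Q \<phi>
    using K.quotient_hom_fibres(1) by (simp add: \<phi>_def[abs_def] Q_def)
  have fibre: "\<phi> a = \<phi> b \<longleftrightarrow> (\<exists>k\<in>K. a = b \<otimes> k)" if "a \<in> carrier G" "b \<in> carrier G" for a b
    using K.quotient_hom_fibres(2)[OF that] by (simp add: \<phi>_def)
  have \<phi>K: "\<phi> k = \<one>\<^bsub>Q\<^esub>" if "k \<in> K" for k
    using fibre[of k \<one>] that K.subset by auto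
  have gen: "subgroup (generate G (insert t K)) G" "K \<subseteq> generate G (insert t K)"
      "t \<in> generate G (insert t K)" if "t \<in> carrier G" for t
    using generate_is_subgroup[of "insert t K"] that K.subset by (auto intro: generate.incl)
  have pow: "\<exists>i::int. \<phi> (w \<otimes> t \<otimes> inv w) = \<phi> t [^]\<^bsub>Q\<^esub> i" if t: "t \<in> carrier G" and w: "w \<in> carrier G" for t w
  proof -
    interpret C: normal "generate G (insert t K)" G using dedekind gen[OF t] by blast
    have "w \<otimes> t \<otimes> inv w \<in> generate G (insert t K)" by (rule C.inv_op_closed2[OF w gen(3)[OF t]])
    then show ?thesis using \<phi>.hom_generate_insert_kernel[OF t K.subset] \<phi>K by blast
  qed
  have central: "\<phi> c \<otimes>\<^bsub>Q\<^esub> \<phi> t = \<phi> t \<otimes>\<^bsub>Q\<^esub> \<phi> c" if "t \<in> carrier G" for t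
    unfolding c_def by (rule \<phi>.hom_commutator_central[OF pow x gh(2) that])
  define M where "M = generate G (insert c K)"
  \<comment> \<open>The inclusion is strict because of \<open>c\<close>, so the quotient by
    \<open>M\<close> is abelian by maximality of \<open>K\<close>.\<close>
  have KM: "K \<subset> M" using gen(2,3)[OF c(1)] c(2) by (auto simp: M_def)
  have M: "M \<lhd> G" unfolding M_def using dedekind gen(1,2)[OF c(1)] by blast
  interpret M: normal M G by (rule M)
  have "(\<Sum>m\<in>M. red_norm G 1 (\<lambda>_ _. ind {x}) (x \<otimes> m)) \<noteq> 1"
  proof (rule no_unit_coset_sum[OF nr K M.subgroup_axioms KM x])
    show "ind {x} \<in> grp_ring G \<int>" using x by (intro ind_grp_ring) auto
    fix m assume m: "m \<in> M"
    obtain w where w: "w \<in> carrier G" "\<phi> (w \<otimes> x \<otimes> inv w) = \<phi> (x \<otimes> m)"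
      using \<phi>.conjugates_fill_coset[OF x gh(2) c_def K.subset \<phi>K central] m by (auto simp: M_def)
    then show "\<exists>y\<in>carrier G. \<exists>k\<in>K. y \<otimes> x \<otimes> inv y = x \<otimes> m \<otimes> k"
      using fibre[of "w \<otimes> x \<otimes> inv w" "x \<otimes> m"] x m by auto
  qed
  then show False using red_norm_element_coset_sum[OF M above[OF M KM] x] by simp
qed

section \<open>The abelian case\<close>

text \<open>The Leibniz formula is evaluated in the group ring. A single integral element represents
  the determinant in all one-dimensional representations at once, since values of integral elements
  are closed under sums, integer multiples and products.\<close>

lemma det_grp_mat_realised:
  assumes H: "int_grp_mat G n H"
  shows "\<exists>z \<in> grp_ring G \<int>. \<forall>\<rho>. is_rep G 1 \<rho> \<longrightarrow>
    rep_ext G 1 \<rho> z $$ (0, 0) = det (rep_blk G 1 \<rho> n H)"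
proof -
  \<comment> \<open>\<open>v\<close> is regarded as a function of the one-dimensional
    representation.\<close>
  define realised where "realised v \<longleftrightarrow> (\<exists>z \<in> grp_ring G \<int>. \<forall>\<rho>. is_rep G 1 \<rho> \<longrightarrow>
    rep_ext G 1 \<rho> z $$ (0, 0) = v \<rho>)" for v
  have realised_sum: "realised (\<lambda>\<rho>. \<Sum>i\<in>I. v i \<rho>)" if v: "\<And>i. i \<in> I \<Longrightarrow> realised (v i)" for I :: "(nat \<Rightarrow> nat) set" and v
  proof -
    obtain z where z: "\<And>i. i \<in> I \<Longrightarrow> z i \<in> grp_ring G \<int>"
      "\<And>i \<rho>. i \<in> I \<Longrightarrow> is_rep G 1 \<rho> \<Longrightarrow> rep_ext G 1 \<rho> (z i) $$ (0, 0) = v i \<rho>"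
      using v unfolding realised_def by metis
    have "(\<lambda>g. \<Sum>i\<in>I. z i g) \<in> grp_ring G \<int>"
      using z(1) by (auto simp: grp_ring_def intro!: Ints_sum)
    moreover have "rep_ext G 1 \<rho> (\<lambda>g. \<Sum>i\<in>I. z i g) $$ (0, 0) = (\<Sum>i\<in>I. v i \<rho>)" if "is_rep G 1 \<rho>" for \<rho>
    proof -
      have "rep_ext G 1 \<rho> (\<lambda>g. \<Sum>i\<in>I. z i g) $$ (0, 0) = (\<Sum>i\<in>I. rep_ext G 1 \<rho> (z i) $$ (0, 0))"
        by (simp add: rep_ext_def sum_distrib_right) (rule sum.swap)
      then show ?thesis using z(2) that by simp
    qed
    ultimately show ?thesis unfolding realised_def by blast
  qed
  have realised_scale: "realised (\<lambda>\<rho>. a * v \<rho>)" if a: "a \<in> \<int>" and v: "realised v" for a v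
  proof -
    obtain z where z: "z \<in> grp_ring G \<int>" "\<And>\<rho>. is_rep G 1 \<rho> \<Longrightarrow> rep_ext G 1 \<rho> z $$ (0, 0) = v \<rho>"
      using v unfolding realised_def by metis
    have "(\<lambda>g. a * z g) \<in> grp_ring G \<int>" using z(1) a by (auto simp: grp_ring_def)
    moreover have "rep_ext G 1 \<rho> (\<lambda>g. a * z g) $$ (0, 0) = a * v \<rho>" if "is_rep G 1 \<rho>" for \<rho>
      using z(2)[OF that] by (simp add: rep_ext_def mult.assoc flip: sum_distrib_left)
    ultimately show ?thesis unfolding realised_def by blast
  qed
  have realised_prod: "realised (\<lambda>\<rho>. \<Prod>i<k. v i \<rho>)" if v: "\<And>i. i < k \<Longrightarrow> realised (v i)" for k :: nat and v
    using v
  proof (induction k)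
    case 0
    have "ind {\<one>} \<in> grp_ring G \<int>" by (intro ind_grp_ring) auto
    moreover have "rep_ext G 1 \<rho> (ind {\<one>}) $$ (0, 0) = 1" if "is_rep G 1 \<rho>" for \<rho>
      unfolding rep_ext_ind_single[OF that one_closed] rep_one[OF that] by simp
    ultimately show ?case unfolding realised_def by auto
  next
    case (Suc k)
    then obtain z u where z: "z \<in> grp_ring G \<int>"
        "\<And>\<rho>. is_rep G 1 \<rho> \<Longrightarrow> rep_ext G 1 \<rho> z $$ (0, 0) = (\<Prod>i<k. v i \<rho>)"
      and u: "u \<in> grp_ring G \<int>" "\<And>\<rho>. is_rep G 1 \<rho> \<Longrightarrow> rep_ext G 1 \<rho> u $$ (0, 0) = v k \<rho>"
      unfolding realised_def by (metis lessI less_SucI)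
    have "rep_ext G 1 \<rho> (grp_mult G z u) $$ (0, 0) = (\<Prod>i<Suc k. v i \<rho>)" if "is_rep G 1 \<rho>" for \<rho>
    proof -
      have "rep_ext G 1 \<rho> (grp_mult G z u) $$ (0, 0) = rep_ext G 1 \<rho> z $$ (0, 0) * rep_ext G 1 \<rho> u $$ (0, 0)"
        unfolding rep_ext_mult[OF that] by (simp add: rep_ext_def scalar_prod_def)
      then show ?thesis using z(2) u(2) that by simp
    qed
    then show ?case unfolding realised_def using grp_mult_grp_ring_Ints[OF z(1) u(1)] by blast
  qed
  have entry: "realised (\<lambda>\<rho>. rep_blk G 1 \<rho> n H $$ (i, j))" if "i < n" "j < n" for i j
    using that H unfolding realised_def int_grp_mat_def by (intro bexI[of _ "H i j"]) (auto simp: rep_blk_def)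
  have "realised (\<lambda>\<rho>. \<Sum>p | p permutes {0..<n}. signof p * (\<Prod>i<n. rep_blk G 1 \<rho> n H $$ (i, p i)))"
  proof (rule realised_sum, rule realised_scale)
    fix p assume p: "p \<in> {p. p permutes {0..<n}}"
    show "signof p \<in> (\<int> :: complex set)" by (simp add: sign_def)
    show "realised (\<lambda>\<rho>. \<Prod>i<n. rep_blk G 1 \<rho> n H $$ (i, p i))"
    proof (rule realised_prod, rule entry)
      fix i assume "i < n" then show "i < n" "p i < n" using p permutes_in_image[of p "{0..<n}" i] by auto
    qed
  qed
  moreover have "det (rep_blk G 1 \<rho> n H)
      = (\<Sum>p | p permutes {0..<n}. signof p * (\<Prod>i<n. rep_blk G 1 \<rho> n H $$ (i, p i)))" for \<rho>
    by (subst det_def'[of _ n]) (auto simp: rep_blk_def atLeast0LessThan)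
  ultimately show ?thesis unfolding realised_def by simp
qed

lemma red_norm_ind_one: "red_norm G 1 (\<lambda>_ _. ind {\<one>}) = ind {\<one>}"
proof (rule red_norm_eqI)
  show "ind {\<one>} \<in> grp_ring G UNIV" by (auto simp: ind_def grp_ring_def)
  fix d \<rho> assume "irr_rep G d \<rho>"
  note rep = irr_repD(2)[OF this]
  show "rep_ext G d \<rho> (ind {\<one>}) = det (rep_blk G d \<rho> 1 (\<lambda>_ _. ind {\<one>})) \<cdot>\<^sub>m 1\<^sub>m d"
    unfolding rep_blk_one rep_ext_ind_single[OF rep one_closed] rep_one[OF rep]
    by (intro eq_matI) auto
qed

lemma one_central: "ind {\<one>} \<in> grp_centre G \<int>"
  by (auto simp: grp_centre_def grp_mult_one_left grp_mult_one_right intro: ind_grp_ring)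

lemma red_norm_in_integrality_ring:
  assumes "h \<in> grp_ring G \<int>"
  shows "red_norm G 1 (\<lambda>_ _. h) \<in> integrality_ring G"
proof -
  have "red_norm G 1 (\<lambda>_ _. h) = (\<lambda>y. \<Sum>i<1::nat. grp_mult G (ind {\<one>}) (red_norm G 1 (\<lambda>_ _. h)) y)"
    using grp_mult_one_left[OF red_norm_single_grp_ring] by simp
  then show ?thesis unfolding integrality_ring_def
    using one_central assms
    by (intro CollectI exI[of _ "1::nat"] exI[of _ "\<lambda>_. ind {\<one>}"] exI[of _ "\<lambda>_. 1"] exI[of _ "\<lambda>_ _ _. h"])
      (auto simp: int_grp_mat_def)
qed

text \<open>All irreducible representations are one-dimensional, so reduced norms are determinants
  and are integral; the centre is the whole integral group ring.\<close>

lemma comm_integrality_ring: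
  assumes "comm_group G"
  shows "integrality_ring G = grp_centre G \<int>"
proof -
  interpret comm_group G by (rule assms)
  have dim: "d = 1" if irr: "irr_rep G d \<rho>" for d \<rho>
    using irr_commuting_dim_one[OF irr] rep_mult[OF irr_repD(2)[OF irr]] m_comm by metis
  have centre: "grp_centre G \<int> = grp_ring G \<int>"
  proof -
    \<comment> \<open>Commutativity is checked in the irreducible representations, where 1 x 1
      matrices commute.\<close>
    have "grp_mult G f h = grp_mult G h f" for f h
    proof (rule irr_reps_separate[OF grp_mult_grp_ring_UNIV grp_mult_grp_ring_UNIV])
      fix d \<rho> assume irr: "irr_rep G d \<rho>"
      show "rep_ext G d \<rho> (grp_mult G f h) = rep_ext G d \<rho> (grp_mult G h f)"
        unfolding rep_ext_mult[OF irr_repD(2)[OF irr]] using dim[OF irr]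
        by (intro eq_matI) (auto simp: rep_ext_def scalar_prod_def)
    qed
    then show ?thesis by (auto simp: grp_centre_def)
  qed
  have nr: "red_norm G n H \<in> grp_ring G \<int>" if H: "int_grp_mat G n H" for n H
  proof -
    obtain z where z: "z \<in> grp_ring G \<int>"
      "\<And>\<rho>. is_rep G 1 \<rho> \<Longrightarrow> rep_ext G 1 \<rho> z $$ (0, 0) = det (rep_blk G 1 \<rho> n H)"
      using det_grp_mat_realised[OF H] by blast
    have "red_norm G n H = z"
    proof (rule red_norm_eqI[OF grp_ring_mono[OF z(1)]])
      fix d \<rho> assume irr: "irr_rep G d \<rho>"
      note d = dim[OF irr]
      have "is_rep G 1 \<rho>" using irr_repD(2)[OF irr] by (simp only: d)
      then have "rep_ext G 1 \<rho> z = det (rep_blk G 1 \<rho> n H) \<cdot>\<^sub>m 1\<^sub>m 1"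
        using z(2) by (intro eq_matI) (auto simp: rep_ext_def)
      then show "rep_ext G d \<rho> z = det (rep_blk G d \<rho> n H) \<cdot>\<^sub>m 1\<^sub>m d" by (simp only: d)
    qed
    then show ?thesis using z(1) by simp
  qed
  show ?thesis
  proof (rule equalityI; rule subsetI)
    fix z assume "z \<in> integrality_ring G"
    then obtain k :: nat and c n H where
      i: "\<And>i. i < k \<Longrightarrow> c i \<in> grp_ring G \<int> \<and> int_grp_mat G (n i) (H i)"
      and z: "z = (\<lambda>x. \<Sum>i<k. grp_mult G (c i) (red_norm G (n i) (H i)) x)"
      unfolding integrality_ring_def centre by blast
    have "grp_mult G (c i) (red_norm G (n i) (H i)) \<in> grp_ring G \<int>" if "i < k" for i
      using i[OF that] nr grp_mult_grp_ring_Ints by blast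
    then show "z \<in> grp_centre G \<int>" unfolding centre z by (auto simp: grp_ring_def intro!: Ints_sum)
  next
    fix z assume z: "z \<in> grp_centre G \<int>"
    \<comment> \<open>A central \<open>z\<close> is itself times the reduced norm of the
      identity.\<close>
    then have "z = (\<lambda>x. \<Sum>i<1::nat. grp_mult G z (red_norm G 1 (\<lambda>_ _. ind {\<one>})) x)"
      unfolding red_norm_ind_one using grp_mult_one_right[of z] by (auto simp: centre)
    then show "z \<in> integrality_ring G" unfolding integrality_ring_def
      using z ind_grp_ring[of "{\<one>}"]
      by (intro CollectI exI[of _ "1::nat"] exI[of _ "\<lambda>_. z"] exI[of _ "\<lambda>_. 1"]
          exI[of _ "\<lambda>_ _ _. ind {\<one>}"]) (auto simp: int_grp_mat_def)
  qed
qed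

end

theorem theorem3p6:
  fixes G :: "('a, 'b) monoid_scheme"
  assumes "group G" and "finite (carrier G)"
  shows "integrality_ring G = grp_centre G \<int> \<longleftrightarrow> comm_group G"
proof -
  interpret finite_group G
    using assms by (simp add: finite_group_def finite_group_axioms_def)
  show ?thesis
    using comm_group_if_red_norm_integral red_norm_in_integrality_ring comm_integrality_ring by blast
qed

end
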